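(* Let $q$ be a prime with $q\equiv 3\pmod 4$ and $n=(q+1)/2$. Then the Paley $\mathrm{ETF}(q+1,(q+1)/2)$ is (up to switching equivalence) a genuine projective dihedral frame, i.e. it is switching equivalent to a configuration $(\pi(g)v)_{g\in D_n}$ where $v\in\mathbb{C}^n$ is a unit vector and $\pi:D_n\to U(n)$ is a projective unitary representation not equivalent to a strict representation.
   Context: $\mathbb{P}^1_q$ is the projective line over $\mathbb F_q$ (nonzero vectors of $\mathbb F_q^2$ modulo nonzero scalars), with $q+1$ points; choose for each $P$ a representative $\hat P\in\mathbb F_q^2\setminus\{0\}$. For $a\in\mathbb F_q$ let $\left(\frac{a}{q}\right)=1$ if $a$ is a square in $\mathbb F_q$ (including $a=0$) and $-1$ otherwise. The Paley matrix is $H_q=\left(\left(\frac{\det(\hat P,\hat Q)}{q}\right)\right)_{P,Q\in\mathbb{P}^1_q}$, a skew Hadamard matrix of order $q+1$ (where $\det((a,b),(c,d))=ad-bc$). The Paley $\mathrm{ETF}(q+1,(q+1)/2)$ is any family of $q+1$ unit vectors in $\mathbb{C}^{(q+1)/2}$ whose Gram matrix is $I+\frac{\mathrm{i}}{\sqrt q}(H_q-I)$; it is well defined up to switching equivalence. Configurations $\Phi,\Psi$ are switching equivalent if $\Psi=Q\Phi\Pi^*$ with $Q$ unitary and $\Pi$ phase monomial (unimodular diagonal times permutation). $D_n$ is generated by $\mu,\tau$ with $\mu^n=\tau^2=1$, $\tau\mu=\mu^{-1}\tau$. A projective unitary representation $\pi$ satisfies $\pi(gg')=c\,\pi(g)\pi(g')$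 with $|c|=1$; it is strict if a homomorphism; $\pi,\pi'$ are equivalent if for a fixed unitary $U$, $U\pi(g)U^*$ equals $\pi'(g)$ up to unimodular scalars. *)

theory Defs
  imports
    "HOL-Number_Theory.Residues"
    "HOL-Algebra.Generated_Groups"
    "Jordan_Normal_Form.Schur_Decomposition"
begin

section \<open>The projective line and the Paley matrix\<close>

definition nonzero_pairs :: "('a, 'm) ring_scheme \<Rightarrow> ('a \<times> 'a) set" where
  "nonzero_pairs R = carrier R \<times> carrier R - {(\<zero>\<^bsub>R\<^esub>, \<zero>\<^bsub>R\<^esub>)}"

definition proportional :: "('a, 'm) ring_scheme \<Rightarrow> (('a \<times> 'a) \<times> ('a \<times> 'a)) set" where
  "proportional R = {(x, y). x \<in> nonzero_pairs R \<and> y \<in> nonzero_pairs R \<and>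
     (\<exists>c \<in> carrier R - {\<zero>\<^bsub>R\<^esub>}. y = (c \<otimes>\<^bsub>R\<^esub> fst x, c \<otimes>\<^bsub>R\<^esub> snd x))}"

definition projective_line :: "('a, 'm) ring_scheme \<Rightarrow> ('a \<times> 'a) set set" where
  "projective_line R = nonzero_pairs R // proportional R"

definition det2 :: "('a, 'm) ring_scheme \<Rightarrow> 'a \<times> 'a \<Rightarrow> 'a \<times> 'a \<Rightarrow> 'a" where
  "det2 R x y = (fst x \<otimes>\<^bsub>R\<^esub> snd y) \<ominus>\<^bsub>R\<^esub> (snd x \<otimes>\<^bsub>R\<^esub> fst y)"

text \<open>Unlike the Legendre symbol of the library, this symbol takes the value 1 at zero; hence
  the diagonal of the Paley matrix consists of ones.\<close>

definition quad_symbol :: "('a, 'm) ring_scheme \<Rightarrow> 'a \<Rightarrow> int" where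
  "quad_symbol R a = (if \<exists>x \<in> carrier R. a = x \<otimes>\<^bsub>R\<^esub> x then 1 else - 1)"

definition representatives :: "('a, 'm) ring_scheme \<Rightarrow> (('a \<times> 'a) set \<Rightarrow> 'a \<times> 'a) \<Rightarrow> bool" where
  "representatives R rep \<longleftrightarrow> (\<forall>P \<in> projective_line R. rep P \<in> P)"

definition paley_matrix ::
  "('a, 'm) ring_scheme \<Rightarrow> (('a \<times> 'a) set \<Rightarrow> 'a \<times> 'a) \<Rightarrow> ('a \<times> 'a) set \<Rightarrow> ('a \<times> 'a) set \<Rightarrow> int"
  where "paley_matrix R rep P Q = quad_symbol R (det2 R (rep P) (rep Q))"

section \<open>Configurations of vectors\<close>

definition unit_vector :: "nat \<Rightarrow> complex vec \<Rightarrow> bool" where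
  "unit_vector n v \<longleftrightarrow> v \<in> carrier_vec n \<and> v \<bullet>c v = 1"

definition unitary :: "nat \<Rightarrow> complex mat \<Rightarrow> bool" where
  "unitary n U \<longleftrightarrow> U \<in> carrier_mat n n \<and> U * mat_adjoint U = 1\<^sub>m n \<and> mat_adjoint U * U = 1\<^sub>m n"

text \<open>A configuration is identified with the matrix whose columns are its vectors, so that its
  Gram matrix is the product of the adjoint of this matrix with the matrix itself. As
  \<open>\<bullet>c\<close> conjugates its second argument, the order of the arguments is reversed here.\<close>

definition gram :: "('i \<Rightarrow> complex vec) \<Rightarrow> 'i \<Rightarrow> 'i \<Rightarrow> complex" where
  "gram \<Phi> i j = \<Phi> j \<bullet>c \<Phi> i"

text \<open>Column \<open>j\<close> of the product of a unitary \<open>Q\<close>, the configuration \<open>\<Phi>\<close> and the adjoint of a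
  phase monomial matrix. The two configurations may have different index sets \<open>I\<close> and \<open>J\<close>, so
  the permutation is a bijection \<open>\<sigma>\<close> from \<open>J\<close> to \<open>I\<close>; \<open>d\<close> gives the phases.\<close>

definition switching_equivalent ::
  "nat \<Rightarrow> 'i set \<Rightarrow> ('i \<Rightarrow> complex vec) \<Rightarrow> 'j set \<Rightarrow> ('j \<Rightarrow> complex vec) \<Rightarrow> bool" where
  "switching_equivalent n I \<Phi> J \<Psi> \<longleftrightarrow>
     (\<exists>Q \<sigma> d. unitary n Q \<and> bij_betw \<sigma> J I \<and> (\<forall>j \<in> J. cmod (d j) = 1) \<and>
        (\<forall>j \<in> J. \<Psi> j = d j \<cdot>\<^sub>v (Q *\<^sub>v \<Phi> (\<sigma> j))))"

definition paley_etf ::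
  "nat \<Rightarrow> ((int \<times> int) set \<Rightarrow> int \<times> int) \<Rightarrow> ((int \<times> int) set \<Rightarrow> complex vec) \<Rightarrow> bool" where
  "paley_etf q rep \<Phi> \<longleftrightarrow>
     (let F = residue_ring (int q) in
       (\<forall>P \<in> projective_line F. unit_vector ((q + 1) div 2) (\<Phi> P)) \<and>
       (\<forall>P \<in> projective_line F. \<forall>Q \<in> projective_line F.
          gram \<Phi> P Q = of_bool (P = Q) +
            \<i> / of_real (sqrt (real q)) * (of_int (paley_matrix F rep P Q) - of_bool (P = Q))))"

section \<open>Dihedral groups\<close>

text \<open>The pair \<open>(i, s)\<close> stands for \<open>\<mu> ^ i\<close> if \<open>s\<close> is false and for \<open>\<mu> ^ i \<tau>\<close> if \<open>s\<close> is true.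
  The lemmas below verify the defining relations; together with the order \<open>2 * n\<close> they
  determine the group up to isomorphism.\<close>

definition dihedral_group :: "nat \<Rightarrow> (nat \<times> bool) monoid" where
  "dihedral_group n =
     \<lparr>carrier = {0..<n} \<times> UNIV,
      monoid.mult = (\<lambda>(i, s) (j, t). ((if s then i + (n - j) else i + j) mod n, s \<noteq> t)),
      one = (0, False)\<rparr>"

definition dihedral_mu :: "nat \<Rightarrow> nat \<times> bool" where
  "dihedral_mu n = (1 mod n, False)"

definition dihedral_tau :: "nat \<times> bool" where
  "dihedral_tau = (0, True)"

lemma dihedral_order: "Coset.order (dihedral_group n) = 2 * n"
  by (simp add: Coset.order_def dihedral_group_def card_cartesian_product)

lemma dihedral_mod_minus:
  assumes "j < n"
  shows "int ((i + (n - j)) mod n) = (int i - int j) mod int n"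
proof -
  have "int ((i + (n - j)) mod n) = (int i - int j + int n) mod int n"
    using assms by (simp add: of_nat_mod of_nat_diff algebra_simps)
  then show ?thesis by simp
qed

lemma dihedral_mult_int:
  assumes "j < n"
  shows "(i, s) \<otimes>\<^bsub>dihedral_group n\<^esub> (j, t) =
    (nat ((if s then int i - int j else int i + int j) mod int n), s \<noteq> t)"
  using dihedral_mod_minus[OF assms, of i] assms
  by (simp add: dihedral_group_def nat_mod_distrib nat_add_distrib flip: dihedral_mod_minus)

lemma dihedral_group_is_group:
  assumes n: "n > 0"
  shows "group (dihedral_group n)"
proof (rule groupI)
  show "\<one>\<^bsub>dihedral_group n\<^esub> \<in> carrier (dihedral_group n)"
    using n by (simp add: dihedral_group_def)
next
  fix x y assume "x \<in> carrier (dihedral_group n)" "y \<in> carrier (dihedral_group n)"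
  then show "x \<otimes>\<^bsub>dihedral_group n\<^esub> y \<in> carrier (dihedral_group n)"
    using n by (auto simp: dihedral_group_def)
next
  fix x y z
  assume "x \<in> carrier (dihedral_group n)" "y \<in> carrier (dihedral_group n)"
    "z \<in> carrier (dihedral_group n)"
  then obtain i s j t k u where xyz: "x = (i, s)" "y = (j, t)" "z = (k, u)"
    and lt: "i < n" "j < n" "k < n"
    by (auto simp: dihedral_group_def)
  have pos: "nat (a mod int n) < n" for a :: int
    using n by (simp add: nat_less_iff)
  have m: "int (nat (a mod int n)) = a mod int n" for a :: int
    using n by simp
  show "x \<otimes>\<^bsub>dihedral_group n\<^esub> y \<otimes>\<^bsub>dihedral_group n\<^esub> z =
      x \<otimes>\<^bsub>dihedral_group n\<^esub> (y \<otimes>\<^bsub>dihedral_group n\<^esub> z)"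
    unfolding xyz dihedral_mult_int[OF lt(2)] dihedral_mult_int[OF lt(3)]
      dihedral_mult_int[OF pos] m
    by (auto simp: mod_simps algebra_simps)
next
  fix x assume "x \<in> carrier (dihedral_group n)"
  then show "\<one>\<^bsub>dihedral_group n\<^esub> \<otimes>\<^bsub>dihedral_group n\<^esub> x = x"
    by (auto simp: dihedral_group_def)
next
  fix x assume "x \<in> carrier (dihedral_group n)"
  then obtain i s where x: "x = (i, s)" "i < n" by (auto simp: dihedral_group_def)
  have "(if s then i else (n - i) mod n, s) \<otimes>\<^bsub>dihedral_group n\<^esub> x = \<one>\<^bsub>dihedral_group n\<^esub>"
    using x by (simp add: dihedral_group_def mod_simps)
  moreover have "(if s then i else (n - i) mod n, s) \<in> carrier (dihedral_group n)"
    using x n by (simp add: dihedral_group_def)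
  ultimately show "\<exists>y \<in> carrier (dihedral_group n). y \<otimes>\<^bsub>dihedral_group n\<^esub> x = \<one>\<^bsub>dihedral_group n\<^esub>"
    by blast
qed

lemma dihedral_mu_pow: "dihedral_mu n [^]\<^bsub>dihedral_group n\<^esub> (k::nat) = (k mod n, False)"
  by (induction k) (simp_all add: nat_pow_def dihedral_group_def dihedral_mu_def mod_simps)

lemma dihedral_relations:
  assumes "n > 0"
  defines "G \<equiv> dihedral_group n"
  shows "dihedral_mu n [^]\<^bsub>G\<^esub> n = \<one>\<^bsub>G\<^esub>"
    and "dihedral_tau [^]\<^bsub>G\<^esub> (2::nat) = \<one>\<^bsub>G\<^esub>"
    and "dihedral_tau \<otimes>\<^bsub>G\<^esub> dihedral_mu n = inv\<^bsub>G\<^esub> (dihedral_mu n) \<otimes>\<^bsub>G\<^esub> dihedral_tau"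
    and "generate G {dihedral_mu n, dihedral_tau} = carrier G"
proof -
  interpret G: group G
    unfolding G_def by (rule dihedral_group_is_group[OF assms(1)])
  have mem: "dihedral_mu n \<in> carrier G" "dihedral_tau \<in> carrier G"
    using assms(1) by (auto simp: G_def dihedral_group_def dihedral_mu_def dihedral_tau_def)
  show "dihedral_mu n [^]\<^bsub>G\<^esub> n = \<one>\<^bsub>G\<^esub>"
    unfolding G_def dihedral_mu_pow by (simp add: dihedral_group_def)
  have "dihedral_tau \<otimes>\<^bsub>G\<^esub> dihedral_tau = \<one>\<^bsub>G\<^esub>"
    using assms(1) by (simp add: G_def dihedral_group_def dihedral_tau_def)
  then show "dihedral_tau [^]\<^bsub>G\<^esub> (2::nat) = \<one>\<^bsub>G\<^esub>"
    using mem by (simp add: numeral_2_eq_2)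
  have "dihedral_mu n \<otimes>\<^bsub>G\<^esub> (dihedral_tau \<otimes>\<^bsub>G\<^esub> dihedral_mu n) = dihedral_tau"
    using assms(1)
    by (cases "n = 1") (auto simp: G_def dihedral_group_def dihedral_mu_def dihedral_tau_def mod_simps)
  then show "dihedral_tau \<otimes>\<^bsub>G\<^esub> dihedral_mu n = inv\<^bsub>G\<^esub> (dihedral_mu n) \<otimes>\<^bsub>G\<^esub> dihedral_tau"
    using mem by (metis G.inv_solve_left G.m_closed)
  show "generate G {dihedral_mu n, dihedral_tau} = carrier G"
  proof (rule antisym)
    show "generate G {dihedral_mu n, dihedral_tau} \<subseteq> carrier G"
      using mem by (intro G.generate_incl) auto
    have pow: "dihedral_mu n [^]\<^bsub>G\<^esub> (k::nat) \<in> generate G {dihedral_mu n, dihedral_tau}" for k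
      by (induction k) (auto intro: generate.one generate.eng generate.incl)
    show "carrier G \<subseteq> generate G {dihedral_mu n, dihedral_tau}"
    proof
      fix x assume "x \<in> carrier G"
      then obtain i s where x: "x = (i, s)" "i < n" by (auto simp: G_def dihedral_group_def)
      have i: "(i, False) \<in> generate G {dihedral_mu n, dihedral_tau}"
        using pow[of i] x(2) by (simp add: G_def dihedral_mu_pow)
      have "(i, False) \<otimes>\<^bsub>G\<^esub> dihedral_tau = (i, True)"
        using x(2) by (simp add: G_def dihedral_group_def dihedral_tau_def)
      then have "(i, True) \<in> generate G {dihedral_mu n, dihedral_tau}"
        using generate.eng[OF i generate.incl] by fastforce
      with i show "x \<in> generate G {dihedral_mu n, dihedral_tau}"
        by (cases s) (simp_all add: x(1))
    qed
  qed
qed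

section \<open>Projective unitary representations\<close>

definition projective_unitary_rep ::
  "('g, 'm) monoid_scheme \<Rightarrow> nat \<Rightarrow> ('g \<Rightarrow> complex mat) \<Rightarrow> bool" where
  "projective_unitary_rep G n \<pi> \<longleftrightarrow>
     (\<forall>g \<in> carrier G. unitary n (\<pi> g)) \<and>
     (\<forall>g \<in> carrier G. \<forall>h \<in> carrier G.
        \<exists>c. cmod c = 1 \<and> \<pi> (g \<otimes>\<^bsub>G\<^esub> h) = c \<cdot>\<^sub>m (\<pi> g * \<pi> h))"

definition strict_unitary_rep ::
  "('g, 'm) monoid_scheme \<Rightarrow> nat \<Rightarrow> ('g \<Rightarrow> complex mat) \<Rightarrow> bool" where
  "strict_unitary_rep G n \<pi> \<longleftrightarrow>
     projective_unitary_rep G n \<pi> \<and>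
     (\<forall>g \<in> carrier G. \<forall>h \<in> carrier G. \<pi> (g \<otimes>\<^bsub>G\<^esub> h) = \<pi> g * \<pi> h)"

definition projectively_equivalent ::
  "('g, 'm) monoid_scheme \<Rightarrow> nat \<Rightarrow> ('g \<Rightarrow> complex mat) \<Rightarrow> ('g \<Rightarrow> complex mat) \<Rightarrow> bool" where
  "projectively_equivalent G n \<pi> \<pi>' \<longleftrightarrow>
     (\<exists>U. unitary n U \<and>
        (\<forall>g \<in> carrier G. \<exists>c. cmod c = 1 \<and> U * \<pi> g * mat_adjoint U = c \<cdot>\<^sub>m \<pi>' g))"

definition genuine_projective_rep ::
  "('g, 'm) monoid_scheme \<Rightarrow> nat \<Rightarrow> ('g \<Rightarrow> complex mat) \<Rightarrow> bool" where
  "genuine_projective_rep G n \<pi> \<longleftrightarrow>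
     projective_unitary_rep G n \<pi> \<and>
     \<not> (\<exists>\<pi>'. strict_unitary_rep G n \<pi>' \<and> projectively_equivalent G n \<pi> \<pi>')"

end

theory Submission
  imports Defs "HOL-Number_Theory.Euler_Criterion"
begin

text \<open>As -1 is a non-square modulo \<open>q\<close>, the plane over the prime field is the field \<open>L\<close> with
  \<open>q\<^sup>2\<close> elements, and \<open>det(x, y)\<close> is the imaginary part of \<open>x\<^sup>* y\<close>. Let \<open>\<zeta>\<close> generate the cyclic
  group of norm-one elements, of order \<open>q + 1 = 2n\<close>, and let \<open>\<omega>\<close> have norm -1. The maps
  \<open>x \<mapsto> \<zeta>\<^sup>i x\<close> and \<open>x \<mapsto> \<zeta>\<^sup>i \<omega> x\<^sup>*\<close> have determinant 1 and, because \<open>\<zeta>\<^sup>n = -1\<close>, compose like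
  the elements of \<open>D\<^sub>n\<close> up to sign; the norm separates rotations from reflections, so the orbit of
  the point of 1 is the whole projective line, which has \<open>2n\<close> points.

  Extend \<open>\<Phi>\<close> to nonzero vectors by \<open>\<Phi>(c x) = \<chi>(c) \<Phi>(x)\<close>. The Gram matrix only depends on
  determinants, hence is invariant under these maps. A family of unit vectors with this Gram
  matrix attains the minimal frame potential and so is a tight frame; two tight frames with the
  same Gram matrix differ by a unitary. This yields unitaries \<open>\<rho>(g)\<close> permuting the frame up to
  sign. As \<open>\<chi>(-1) = -1\<close>, the images of the commuting elements \<open>\<mu>\<^bsup>n/2\<^esup>\<close> and \<open>\<tau>\<close> anticommute,
  which excludes an equivalence with a strict representation.\<close>

section \<open>Tight frames\<close>

lemma cscalar_prod_sum:
  assumes "w \<in> carrier_vec n"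
  shows "v \<bullet>c w = (\<Sum>r<n. v $ r * cnj (w $ r))"
  using assms by (auto simp: scalar_prod_def lessThan_atLeast0 intro!: sum.cong)

lemma index_mat_adjoint:
  assumes "A \<in> carrier_mat n m" "i < m" "j < n"
  shows "mat_adjoint A $$ (i, j) = cnj (A $$ (j, i))"
  using assms by (auto simp: mat_adjoint_def mat_of_rows_def)

lemma mat_adjoint_carrier: "A \<in> carrier_mat n m \<Longrightarrow> mat_adjoint A \<in> carrier_mat m n"
  unfolding mat_adjoint_def by (metis carrier_matD length_map cols_length mat_of_rows_carrier(1))

lemma index_mult_mat_vec_sum:
  assumes "A \<in> carrier_mat n m" "v \<in> carrier_vec m" "r < n"
  shows "(A *\<^sub>v v) $ r = (\<Sum>s<m. A $$ (r, s) * v $ s)"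
  using assms by (auto simp: scalar_prod_def lessThan_atLeast0 intro!: sum.cong)

lemma index_mult_mat_sum:
  assumes "A \<in> carrier_mat n m" "B \<in> carrier_mat m k" "r < n" "s < k"
  shows "(A * B) $$ (r, s) = (\<Sum>t<m. A $$ (r, t) * B $$ (t, s))"
  using assms by (auto simp: scalar_prod_def lessThan_atLeast0 intro!: sum.cong)

lemma sum_swap_pairs:
  "(\<Sum>a\<in>A. \<Sum>b\<in>B. \<Sum>c\<in>C. \<Sum>d\<in>D. f a b c d) =
    (\<Sum>c\<in>C. \<Sum>d\<in>D. \<Sum>a\<in>A. \<Sum>b\<in>B. f a b c d)"
proof -
  have "(\<Sum>a\<in>A. \<Sum>b\<in>B. \<Sum>c\<in>C. \<Sum>d\<in>D. f a b c d) =
      (\<Sum>a\<in>A. \<Sum>c\<in>C. \<Sum>b\<in>B. \<Sum>d\<in>D. f a b c d)"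
    by (rule sum.cong[OF refl], rule sum.swap)
  also have "\<dots> = (\<Sum>c\<in>C. \<Sum>a\<in>A. \<Sum>b\<in>B. \<Sum>d\<in>D. f a b c d)"
    by (rule sum.swap)
  also have "\<dots> = (\<Sum>c\<in>C. \<Sum>a\<in>A. \<Sum>d\<in>D. \<Sum>b\<in>B. f a b c d)"
    by (rule sum.cong[OF refl], rule sum.cong[OF refl], rule sum.swap)
  also have "\<dots> = (\<Sum>c\<in>C. \<Sum>d\<in>D. \<Sum>a\<in>A. \<Sum>b\<in>B. f a b c d)"
    by (rule sum.cong[OF refl], rule sum.swap)
  finally show ?thesis .
qed

lemma sum_sum_nonneg_0:
  fixes g :: "nat \<Rightarrow> nat \<Rightarrow> real"
  assumes nonneg: "\<And>r s. 0 \<le> g r s" and zero: "(\<Sum>r<n. \<Sum>s<m. g r s) = 0" and "r < n" "s < m"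
  shows "g r s = 0"
proof -
  have "g r s \<le> (\<Sum>s<m. g r s)"
    using nonneg assms(4) by (intro member_le_sum) auto
  also have "\<dots> \<le> (\<Sum>r<n. \<Sum>s<m. g r s)"
    by (rule member_le_sum[where f = "\<lambda>r. \<Sum>s<m. g r s"]) (simp_all add: sum_nonneg nonneg assms(3))
  finally show ?thesis using zero nonneg[of r s] by linarith
qed

text \<open>Let F be the frame operator, the sum of the rank-one operators given by the vectors. Its
  trace is the sum of the diagonal Gram entries and its squared Hilbert-Schmidt norm is the frame
  potential, so the hypotheses \<open>c\<close> and \<open>pot\<close> force the squared distance
  from F to c times the identity to be n|c|^2 - 2n|c|^2 + n|c|^2 = 0.\<close>

lemma tight_of_frame_potential:
  fixes f :: "'i \<Rightarrow> complex vec"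
  assumes fin: "finite I" and dim: "\<And>P. P \<in> I \<Longrightarrow> f P \<in> carrier_vec n"
    and c: "of_nat n * c = (\<Sum>P\<in>I. gram f P P)"
    and pot: "(\<Sum>P\<in>I. \<Sum>Q\<in>I. gram f P Q * cnj (gram f P Q)) = of_nat n * c * cnj c"
    and rs: "r < n" "s < n"
  shows "(\<Sum>P\<in>I. f P $ r * cnj (f P $ s)) = (if r = s then c else 0)"
proof -
  define F where "F r s = (\<Sum>P\<in>I. f P $ r * cnj (f P $ s))" for r s
  define d where "d r s = (if r = s then c else 0)" for r s :: nat
  have d_right: "(\<Sum>s<n. x s * cnj (d r s)) = x r * cnj c" if "r < n" for x r
  proof -
    have "(\<Sum>s<n. x s * cnj (d r s)) = (\<Sum>s<n. if s = r then x r * cnj c else 0)"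
      by (intro sum.cong refl) (auto simp: d_def)
    then show ?thesis using that by simp
  qed
  have gram: "gram f P Q = (\<Sum>r<n. f Q $ r * cnj (f P $ r))" if "P \<in> I" "Q \<in> I" for P Q
    using that dim by (simp add: gram_def cscalar_prod_sum)
  have tr: "(\<Sum>r<n. F r r) = of_nat n * c"
    unfolding F_def c by (subst sum.swap) (simp add: gram)
  have "(\<Sum>r<n. \<Sum>s<n. F r s * cnj (F r s)) =
      (\<Sum>r<n. \<Sum>s<n. \<Sum>P\<in>I. \<Sum>Q\<in>I. f P $ r * cnj (f P $ s) * (cnj (f Q $ r) * f Q $ s))"
    by (simp add: F_def sum_product)
  also have "\<dots> = (\<Sum>P\<in>I. \<Sum>Q\<in>I. \<Sum>r<n. \<Sum>s<n. f P $ r * cnj (f P $ s) * (cnj (f Q $ r) * f Q $ s))"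
    by (rule sum_swap_pairs)
  also have "\<dots> = (\<Sum>P\<in>I. \<Sum>Q\<in>I. gram f P Q * cnj (gram f P Q))"
    by (intro sum.cong refl, subst mult.commute) (simp add: gram sum_product mult_ac)
  finally have sq: "(\<Sum>r<n. \<Sum>s<n. F r s * cnj (F r s)) = of_nat n * c * cnj c"
    using pot by simp
  have "(\<Sum>r<n. \<Sum>s<n. (F r s - d r s) * cnj (F r s - d r s)) =
      (\<Sum>r<n. \<Sum>s<n. F r s * cnj (F r s)) - (\<Sum>r<n. \<Sum>s<n. F r s * cnj (d r s))
       - (\<Sum>r<n. \<Sum>s<n. d r s * cnj (F r s)) + (\<Sum>r<n. \<Sum>s<n. d r s * cnj (d r s))"
    by (simp add: algebra_simps sum.distrib sum_subtractf)
  also have "(\<Sum>r<n. \<Sum>s<n. F r s * cnj (d r s)) = of_nat n * c * cnj c"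
    unfolding tr[symmetric] sum_distrib_right by (intro sum.cong refl) (simp add: d_right)
  also have "(\<Sum>r<n. \<Sum>s<n. d r s * cnj (F r s)) = cnj (\<Sum>r<n. \<Sum>s<n. F r s * cnj (d r s))"
    unfolding cnj_sum complex_cnj_mult complex_cnj_cnj by (intro sum.cong refl mult.commute)
  also have "(\<Sum>r<n. \<Sum>s<n. F r s * cnj (d r s)) = of_nat n * c * cnj c"
    unfolding tr[symmetric] sum_distrib_right by (intro sum.cong refl) (simp add: d_right)
  also have "(\<Sum>r<n. \<Sum>s<n. d r s * cnj (d r s)) = of_nat n * c * cnj c"
    by (simp add: d_right) (simp add: d_def)
  also have "(\<Sum>r<n. \<Sum>s<n. F r s * cnj (F r s)) - of_nat n * c * cnj c - cnj (of_nat n * c * cnj c)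
      + of_nat n * c * cnj c = 0"
    unfolding sq by simp
  finally have "(\<Sum>r<n. \<Sum>s<n. (F r s - d r s) * cnj (F r s - d r s)) = 0" .
  \<comment> \<open>Each summand is a squared modulus, so the vanishing complex sum becomes a
    vanishing sum of nonnegative reals.\<close>
  then have "complex_of_real (\<Sum>r<n. \<Sum>s<n. (cmod (F r s - d r s))\<^sup>2) = 0"
    by (simp only: of_real_sum complex_norm_square)
  then have sum0: "(\<Sum>r<n. \<Sum>s<n. (cmod (F r s - d r s))\<^sup>2) = 0"
    by (simp only: of_real_eq_0_iff)
  have "(cmod (F r s - d r s))\<^sup>2 = 0"
    using sum_sum_nonneg_0[where g = "\<lambda>r s. (cmod (F r s - d r s))\<^sup>2", OF _ sum0 rs] by simp
  then have "F r s = d r s" by simp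
  then show ?thesis unfolding F_def d_def .
qed

text \<open>The frame bound is 2 because 2n unit vectors in dimension n have a frame operator of
  trace 2n.\<close>

definition tight :: "nat \<Rightarrow> 'i set \<Rightarrow> ('i \<Rightarrow> complex vec) \<Rightarrow> bool" where
  "tight n I f \<longleftrightarrow> finite I \<and> (\<forall>P\<in>I. f P \<in> carrier_vec n) \<and>
     (\<forall>r<n. \<forall>s<n. (\<Sum>P\<in>I. f P $ r * cnj (f P $ s)) = (if r = s then 2 else 0))"

lemma tightD:
  assumes "tight n I f"
  shows "finite I" "P \<in> I \<Longrightarrow> f P \<in> carrier_vec n"
    "r < n \<Longrightarrow> s < n \<Longrightarrow> (\<Sum>P\<in>I. f P $ r * cnj (f P $ s)) = (if r = s then 2 else 0)"
  using assms by (auto simp: tight_def)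

text \<open>A tight frame spans: any matrix C is half the sum over P of the column C f(P) times the
  adjoint of f(P), so its values on the frame determine it.\<close>

lemma tight_mat_eqI:
  assumes f: "tight n I f" and A: "A \<in> carrier_mat n n" and B: "B \<in> carrier_mat n n"
    and eq: "\<And>P. P \<in> I \<Longrightarrow> A *\<^sub>v f P = B *\<^sub>v f P"
  shows "A = B"
proof (rule eq_matI)
  fix r s assume "r < dim_row B" "s < dim_col B"
  then have rs: "r < n" "s < n" using B by auto
  have expand: "2 * C $$ (r, s) = (\<Sum>P\<in>I. (C *\<^sub>v f P) $ r * cnj (f P $ s))"
    if C: "C \<in> carrier_mat n n" for C
  proof -
    have "(\<Sum>P\<in>I. (C *\<^sub>v f P) $ r * cnj (f P $ s)) =
        (\<Sum>P\<in>I. \<Sum>t<n. C $$ (r, t) * (f P $ t * cnj (f P $ s)))"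
      using C rs tightD[OF f]
      by (intro sum.cong refl) (simp add: index_mult_mat_vec_sum sum_distrib_left sum_distrib_right mult_ac
        del: index_mult_mat_vec)
    also have "\<dots> = (\<Sum>t<n. C $$ (r, t) * (\<Sum>P\<in>I. f P $ t * cnj (f P $ s)))"
      by (subst sum.swap) (simp add: sum_distrib_left)
    also have "\<dots> = (\<Sum>t<n. if t = s then 2 * C $$ (r, s) else 0)"
      using rs tightD(3)[OF f] by (intro sum.cong refl) auto
    also have "\<dots> = 2 * C $$ (r, s)" using rs by simp
    finally show ?thesis by simp
  qed
  have "2 * A $$ (r, s) = 2 * B $$ (r, s)"
    unfolding expand[OF A] expand[OF B] using eq by simp
  then show "A $$ (r, s) = B $$ (r, s)" by simp
qed (use A B in auto)

text \<open>The required unitary is half the synthesis operator of \<open>g\<close> composed with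
  the analysis operator of \<open>f\<close>.\<close>

lemma unitary_of_equal_gram:
  assumes f: "tight n I f" and g: "tight n I g"
    and eq: "\<And>P Q. P \<in> I \<Longrightarrow> Q \<in> I \<Longrightarrow> gram f P Q = gram g P Q"
  obtains U where "unitary n U" "\<And>P. P \<in> I \<Longrightarrow> U *\<^sub>v f P = g P"
proof -
  define U where "U = mat n n (\<lambda>(r, s). (\<Sum>P\<in>I. g P $ r * cnj (f P $ s)) / 2)"
  have U: "U \<in> carrier_mat n n" by (simp add: U_def)
  have U_index: "2 * U $$ (r, s) = (\<Sum>P\<in>I. g P $ r * cnj (f P $ s))" if "r < n" "s < n" for r s
    using that by (simp add: U_def)
  have gram: "gram h P Q = (\<Sum>r<n. h Q $ r * cnj (h P $ r))"
    if "tight n I h" "P \<in> I" "Q \<in> I" for h P Q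
    using tightD(2)[OF that(1)] that by (simp add: gram_def cscalar_prod_sum)
  have Uf: "U *\<^sub>v f P = g P" if P: "P \<in> I" for P
  proof (rule eq_vecI)
    fix r assume "r < dim_vec (g P)"
    then have r: "r < n" using tightD(2)[OF g P] by simp
    have "2 * (U *\<^sub>v f P) $ r = (\<Sum>s<n. 2 * U $$ (r, s) * f P $ s)"
      unfolding index_mult_mat_vec_sum[OF U tightD(2)[OF f P] r] by (simp add: sum_distrib_left mult_ac)
    also have "\<dots> = (\<Sum>s<n. \<Sum>Q\<in>I. g Q $ r * (f P $ s * cnj (f Q $ s)))"
      using r by (simp add: U_index sum_distrib_left mult_ac)
    also have "\<dots> = (\<Sum>Q\<in>I. g Q $ r * gram f Q P)"
      by (subst sum.swap) (use P in \<open>simp add: gram[OF f] sum_distrib_left\<close>)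
    \<comment> \<open>Equality of the Gram matrices replaces \<open>f\<close> by \<open>g\<close>,
      after which tightness of \<open>g\<close> reproduces \<open>g P\<close>.\<close>
    also have "\<dots> = (\<Sum>Q\<in>I. g Q $ r * gram g Q P)"
      using eq P by simp
    also have "\<dots> = (\<Sum>s<n. \<Sum>Q\<in>I. (g Q $ r * cnj (g Q $ s)) * g P $ s)"
      by (subst sum.swap) (use P in \<open>simp add: gram[OF g] sum_distrib_left mult_ac\<close>)
    also have "\<dots> = (\<Sum>s<n. if s = r then 2 * g P $ r else 0)"
      using r tightD(3)[OF g] by (intro sum.cong refl) (auto simp flip: sum_distrib_right)
    also have "\<dots> = 2 * g P $ r" using r by simp
    finally show "(U *\<^sub>v f P) $ r = g P $ r" by simp
  qed (use U tightD(2)[OF g P] in auto)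
  \<comment> \<open>U times its adjoint is half the sum of U f(P) times the adjoint of g(P), which
    by U f = g is half the frame operator of \<open>g\<close>.\<close>
  have UU: "U * mat_adjoint U = 1\<^sub>m n"
  proof (rule eq_matI)
    fix r s assume "r < dim_row (1\<^sub>m n :: complex mat)" "s < dim_col (1\<^sub>m n :: complex mat)"
    then have rs: "r < n" "s < n" by auto
    have "2 * (U * mat_adjoint U) $$ (r, s) =
        (\<Sum>t<n. \<Sum>P\<in>I. U $$ (r, t) * f P $ t * cnj (g P $ s))"
    proof -
      have "2 * (U * mat_adjoint U) $$ (r, s) = (\<Sum>t<n. U $$ (r, t) * cnj (2 * U $$ (s, t)))"
        unfolding index_mult_mat_sum[OF U mat_adjoint_carrier[OF U] rs]
        using rs by (simp add: index_mat_adjoint[OF U] sum_distrib_left mult_ac)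
      also have "\<dots> = (\<Sum>t<n. U $$ (r, t) * cnj (\<Sum>P\<in>I. g P $ s * cnj (f P $ t)))"
        using rs by (intro sum.cong refl) (simp only: U_index lessThan_iff)
      finally show ?thesis
        by (simp add: sum_distrib_left mult_ac)
    qed
    also have "\<dots> = (\<Sum>P\<in>I. (U *\<^sub>v f P) $ r * cnj (g P $ s))"
      by (subst sum.swap) (use rs U tightD(2)[OF f] in \<open>simp add: index_mult_mat_vec_sum
        sum_distrib_right del: index_mult_mat_vec\<close>)
    also have "\<dots> = (if r = s then 2 else 0)"
      using rs Uf tightD(3)[OF g] by simp
    finally show "(U * mat_adjoint U) $$ (r, s) = 1\<^sub>m n $$ (r, s)"
      using rs by (auto split: if_splits)
  qed (use U mat_adjoint_carrier[OF U] in auto)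
  then have "mat_adjoint U * U = 1\<^sub>m n"
    using mat_mult_left_right_inverse[OF U mat_adjoint_carrier[OF U]] by blast
  with UU U have "unitary n U" by (simp add: unitary_def)
  then show ?thesis using Uf that by blast
qed

section \<open>Quadratic residues and the field with \<open>q\<^sup>2\<close> elements\<close>

lemma Legendre_range:
  assumes "\<not> int q dvd a"
  shows "Legendre a (int q) \<in> {1, -1}"
  using assms by (auto simp: Legendre_def cong_0_iff)

text \<open>Distinct signs differ by 2, which m > 2 cannot divide. This turns Euler's criterion from
  a congruence into an equality.\<close>

lemma sign_eqI:
  fixes x y m :: int
  assumes "x \<in> {1, -1}" "y \<in> {1, -1}" "m > 2" "[x = y] (mod m)"
  shows "x = y"
proof (rule ccontr)
  assume "x \<noteq> y"
  then have "m dvd 2" using assms(1,2,4) by (auto simp: cong_iff_dvd_diff)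
  then show False using assms(3) zdvd_imp_le by fastforce
qed

lemma Legendre_mult:
  assumes "prime q" "q > 2" "\<not> int q dvd a" "\<not> int q dvd b"
  shows "Legendre (a * b) (int q) = Legendre a (int q) * Legendre b (int q)"
proof (rule sign_eqI)
  have ab: "\<not> int q dvd a * b"
    using assms by (simp add: prime_dvd_mult_iff)
  have L: "[Legendre x (int q) = x ^ ((q - 1) div 2)] (mod int q)" if "\<not> int q dvd x" for x
    using euler_criterion[of q x] assms(1,2) by simp
  show "[Legendre (a * b) (int q) = Legendre a (int q) * Legendre b (int q)] (mod int q)"
    using L[OF ab] cong_mult[OF L[OF assms(3)] L[OF assms(4)]]
    by (metis cong_sym cong_trans power_mult_distrib)
  show "Legendre (a * b) (int q) \<in> {1, -1}"
    using Legendre_range[OF ab] .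
  show "Legendre a (int q) * Legendre b (int q) \<in> {1, -1}"
    using Legendre_range[OF assms(3)] Legendre_range[OF assms(4)] by auto
qed (use assms in simp)

lemma gt_2_of_cong:
  assumes "[q = 3] (mod 4)"
  shows "q > (2 :: nat)"
  using assms mod_less_eq_dividend[of q 4] by (simp add: cong_def)

text \<open>By Euler's criterion, since (q - 1) / 2 is odd.\<close>

lemma Legendre_minus_one:
  assumes "prime q" "[q = 3] (mod 4)"
  shows "Legendre (- 1) (int q) = - 1"
proof (rule sign_eqI)
  have q: "q mod 4 = 3" using assms(2) by (simp add: cong_def)
  have q2: "q > 2" by (rule gt_2_of_cong[OF assms(2)])
  have "q = 4 * (q div 4) + 3" using q by presburger
  then have "odd ((q - 1) div 2)" by presburger
  moreover have "[Legendre (- 1) (int q) = (- 1) ^ ((q - 1) div 2)] (mod int q)"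
    by (rule euler_criterion) (use assms(1) q2 in auto)
  ultimately show "[Legendre (- 1) (int q) = - 1] (mod int q)"
    by simp
  show "Legendre (- 1) (int q) \<in> {1, - 1}"
    using q2 by (intro Legendre_range) auto
  show "int q > 2" using q2 by simp
qed auto

text \<open>The quadratic character on arbitrary integers, reduced modulo q first so that
  determinants may be computed in the integers. It is 1 on multiples of q and agrees with the
  Legendre symbol off them.\<close>

definition chi :: "nat \<Rightarrow> int \<Rightarrow> int" where
  "chi q a = quad_symbol (residue_ring (int q)) (a mod int q)"

lemma chi_range: "chi q a = 1 \<or> chi q a = -1"
  by (simp add: chi_def quad_symbol_def)

lemma chi_cong: "[a = b] (mod int q) \<Longrightarrow> chi q a = chi q b"
  by (simp add: chi_def cong_def)

lemma chi_eq_Legendre: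
  assumes "q > 0" "\<not> int q dvd a"
  shows "chi q a = Legendre a (int q)"
proof -
  have "(\<exists>x\<in>{0..int q - 1}. a mod int q = x * x mod int q) \<longleftrightarrow> QuadRes (int q) a"
  proof
    assume "QuadRes (int q) a"
    then obtain y where "[y ^ 2 = a] (mod int q)" by (auto simp: QuadRes_def)
    then have "a mod int q = (y mod int q) * (y mod int q) mod int q"
      by (simp add: cong_def power2_eq_square mod_simps)
    moreover have "y mod int q \<in> {0..int q - 1}" using assms(1) by simp
    ultimately show "\<exists>x\<in>{0..int q - 1}. a mod int q = x * x mod int q" by blast
  qed (auto simp: QuadRes_def cong_def power2_eq_square)
  then show ?thesis
    using assms(2) by (simp add: chi_def quad_symbol_def residue_ring_def Legendre_def cong_0_iff)
qed

section \<open>Gaussian integers modulo \<open>m\<close>, the pair (a, b) standing for a + b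
  i\<close>

definition gauss_ring :: "int \<Rightarrow> (int \<times> int) ring" where
  "gauss_ring m =
     \<lparr>carrier = {0..<m} \<times> {0..<m},
      monoid.mult = (\<lambda>(a, b) (c, d). ((a * c - b * d) mod m, (a * d + b * c) mod m)),
      one = (1, 0),
      zero = (0, 0),
      add = (\<lambda>(a, b) (c, d). ((a + c) mod m, (b + d) mod m))\<rparr>"

lemma gauss_ring_simps:
  "carrier (gauss_ring m) = {0..<m} \<times> {0..<m}"
  "(a, b) \<otimes>\<^bsub>gauss_ring m\<^esub> (c, d) = ((a * c - b * d) mod m, (a * d + b * c) mod m)"
  "\<one>\<^bsub>gauss_ring m\<^esub> = (1, 0)"
  "\<zero>\<^bsub>gauss_ring m\<^esub> = (0, 0)"
  "(a, b) \<oplus>\<^bsub>gauss_ring m\<^esub> (c, d) = ((a + c) mod m, (b + d) mod m)"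
  by (simp_all add: gauss_ring_def)

lemma mod_mult_mod_simps:
  fixes a b x y m :: int
  shows "(a * (x mod m) - b * (y mod m)) mod m = (a * x - b * y) mod m"
    and "(a * (x mod m) + b * (y mod m)) mod m = (a * x + b * y) mod m"
    and "((x mod m) * a - (y mod m) * b) mod m = (x * a - y * b) mod m"
    and "((x mod m) * a + (y mod m) * b) mod m = (x * a + y * b) mod m"
  by (rule mod_diff_cong mod_add_cong; rule mod_mult_right_eq mod_mult_left_eq)+

lemma cring_gauss_ring:
  assumes m: "m > 1"
  shows "cring (gauss_ring m)"
proof (rule cringI)
  show "abelian_group (gauss_ring m)"
  proof (rule abelian_groupI)
    fix x assume "x \<in> carrier (gauss_ring m)"
    then obtain a b where x: "x = (a, b)" "0 \<le> a" "a < m" "0 \<le> b" "b < m"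
      by (auto simp: gauss_ring_simps)
    have "((- a) mod m, (- b) mod m) \<oplus>\<^bsub>gauss_ring m\<^esub> x = \<zero>\<^bsub>gauss_ring m\<^esub>"
      using m by (simp add: gauss_ring_simps x mod_simps)
    moreover have "((- a) mod m, (- b) mod m) \<in> carrier (gauss_ring m)"
      using m by (simp add: gauss_ring_simps)
    ultimately show "\<exists>y\<in>carrier (gauss_ring m). y \<oplus>\<^bsub>gauss_ring m\<^esub> x = \<zero>\<^bsub>gauss_ring m\<^esub>"
      by blast
  qed (use m in \<open>auto simp: gauss_ring_simps mod_simps algebra_simps\<close>)
  show "Group.comm_monoid (gauss_ring m)"
    by (rule comm_monoidI)
      (use m in \<open>auto simp: gauss_ring_simps mod_mult_mod_simps\<close>, (simp add: algebra_simps)+)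
  show "(x \<oplus>\<^bsub>gauss_ring m\<^esub> y) \<otimes>\<^bsub>gauss_ring m\<^esub> z =
      x \<otimes>\<^bsub>gauss_ring m\<^esub> z \<oplus>\<^bsub>gauss_ring m\<^esub> y \<otimes>\<^bsub>gauss_ring m\<^esub> z"
    for x y z
    by (cases x; cases y; cases z)
      (simp add: gauss_ring_simps mod_mult_mod_simps mod_add_eq, simp add: algebra_simps)
qed

lemma inverse_mod_prime:
  assumes "prime q" "\<not> int q dvd a"
  obtains c where "[a * c = 1] (mod int q)"
proof -
  have "coprime (int q) a"
    using assms by (intro prime_imp_coprime) simp_all
  then show ?thesis
    using cong_solve_coprime_int[of a "int q"] that by (auto simp: coprime_commute)
qed

text \<open>If one of the two were invertible, dividing by its square would exhibit -1 as a
  square.\<close>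

lemma sum_squares_zero_mod:
  assumes q: "prime q" "[q = 3] (mod 4)" and ab: "int q dvd a * a + b * b"
  shows "int q dvd a \<and> int q dvd b"
proof -
  have *: "int q dvd y" if "int q dvd x * x + y * y" for x y
  proof (rule ccontr)
    assume y: "\<not> int q dvd y"
    then obtain c where c: "[y * c = 1] (mod int q)"
      using inverse_mod_prime[OF q(1)] by blast
    have "(x * c)\<^sup>2 + (y * c)\<^sup>2 = (x * x + y * y) * c\<^sup>2"
      by (simp add: power2_eq_square algebra_simps)
    then have "[(x * c)\<^sup>2 + (y * c)\<^sup>2 = 0] (mod int q)"
      using that by (simp add: cong_0_iff)
    from cong_diff[OF this cong_pow[OF c, of 2]] have "[(x * c)\<^sup>2 = -1] (mod int q)"
      by simp
    then have "QuadRes (int q) (- 1)" by (auto simp: QuadRes_def)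
    then have "Legendre (- 1) (int q) \<noteq> - 1" by (simp add: Legendre_def)
    with Legendre_minus_one[OF q] show False by blast
  qed
  from *[of a b] *[of b a] ab show ?thesis by (simp add: add.commute)
qed

definition gauss_conj :: "int \<Rightarrow> int \<times> int \<Rightarrow> int \<times> int" where
  "gauss_conj m x = (fst x, (- snd x) mod m)"

text \<open>Norm and determinant stay unreduced integers, so facts about them take the form of
  congruences or divisibilities modulo q.\<close>

definition gauss_norm :: "int \<times> int \<Rightarrow> int" where
  "gauss_norm x = fst x * fst x + snd x * snd x"

definition gauss_det :: "int \<times> int \<Rightarrow> int \<times> int \<Rightarrow> int" where
  "gauss_det x y = fst x * snd y - snd x * fst y"

lemma field_gauss_ring:
  assumes q: "prime q" "[q = 3] (mod 4)"
  shows "field (gauss_ring (int q))"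
proof -
  have q1: "int q > 1" using q(1) prime_gt_1_nat by simp
  interpret cring "gauss_ring (int q)" by (rule cring_gauss_ring[OF q1])
  show ?thesis
  proof (rule cring_fieldI2)
    show "\<zero>\<^bsub>gauss_ring (int q)\<^esub> \<noteq> \<one>\<^bsub>gauss_ring (int q)\<^esub>"
      by (simp add: gauss_ring_simps)
    fix x assume x: "x \<in> carrier (gauss_ring (int q))" "x \<noteq> \<zero>\<^bsub>gauss_ring (int q)\<^esub>"
    obtain a b where "x = (a, b)" by (cases x)
    with x have ab: "x = (a, b)" "a \<in> {0..<int q}" "b \<in> {0..<int q}" "\<not> (a = 0 \<and> b = 0)"
      by (auto simp: gauss_ring_simps)
    have "\<not> (int q dvd a \<and> int q dvd b)"
      using ab by (auto dest!: zdvd_imp_le)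
    then have "\<not> int q dvd a * a + b * b"
      using sum_squares_zero_mod[OF q] by blast
    then obtain c where c: "[(a * a + b * b) * c = 1] (mod int q)"
      using inverse_mod_prime[OF q(1)] by blast
    \<comment> \<open>The inverse is the conjugate divided by the norm.\<close>
    let ?y = "((a * c) mod int q, (- b * c) mod int q)"
    have "x \<otimes>\<^bsub>gauss_ring (int q)\<^esub> ?y = \<one>\<^bsub>gauss_ring (int q)\<^esub>"
      by (simp add: ab gauss_ring_simps mod_mult_mod_simps)
        (use c q1 in \<open>simp add: cong_def algebra_simps\<close>)
    moreover have "?y \<in> carrier (gauss_ring (int q))"
      using q1 by (simp add: gauss_ring_simps)
    ultimately show "\<exists>y\<in>carrier (gauss_ring (int q)). x \<otimes>\<^bsub>gauss_ring (int q)\<^esub> y = \<one>\<^bsub>gauss_ring (int q)\<^esub>"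
      by blast
  qed
qed

text \<open>Some non-residue has the form b^2 + 1. As -1 is a non-residue too, -(b^2 + 1) is a
  square s^2, and dividing by it gives (b/s)^2 + (1/s)^2 = -1.\<close>

lemma exists_norm_minus_one:
  assumes q: "prime q" "[q = 3] (mod 4)"
  shows "\<exists>a b. [a * a + b * b = - 1] (mod int q)"
proof -
  have q2: "q > 2"
    by (rule gt_2_of_cong[OF q(2)])
  define P where "P k \<longleftrightarrow> QuadRes (int q) (int k)" for k
  have "\<not> P (q - 1)"
  proof
    assume "P (q - 1)"
    then obtain y where "[y ^ 2 = int (q - 1)] (mod int q)" by (auto simp: P_def QuadRes_def)
    moreover have "[int (q - 1) = - 1] (mod int q)"
      using q2 by (simp add: cong_iff_dvd_diff of_nat_diff)
    ultimately have "QuadRes (int q) (- 1)"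
      unfolding QuadRes_def using cong_trans by blast
    then show False using Legendre_minus_one[OF q] by (simp add: Legendre_def split: if_splits)
  qed
  moreover have "P 0" by (auto simp: P_def QuadRes_def intro: exI[of _ 0])
  \<comment> \<open>0 is a residue and q - 1 is not, so on the way up some residue \<open>k\<close>
    is followed by a non-residue.\<close>
  ultimately obtain k where k: "P k" "\<not> P (Suc k)"
    using nat_induct[of P "q - 1"] by blast
  from k(1) obtain b where b: "[b ^ 2 = int k] (mod int q)" by (auto simp: P_def QuadRes_def)
  have "[b ^ 2 + 1 = int (Suc k)] (mod int q)"
    using cong_add[OF b cong_refl[of 1]] by (simp add: add.commute)
  then have nsq: "\<not> QuadRes (int q) (b ^ 2 + 1)"
    using k(2) unfolding P_def QuadRes_def using cong_trans by blast
  have nz: "\<not> int q dvd b ^ 2 + 1"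
    using sum_squares_zero_mod[OF q, of b 1] q2 by (auto simp: power2_eq_square)
  then have "Legendre (b ^ 2 + 1) (int q) = - 1"
    using nsq by (simp add: Legendre_def cong_0_iff)
  then have "Legendre (- 1 * (b ^ 2 + 1)) (int q) = 1"
    using Legendre_mult[OF q(1) q2 _ nz, of "- 1"] Legendre_minus_one[OF q] q2 by simp
  then obtain s where s: "[s ^ 2 = - 1 * (b ^ 2 + 1)] (mod int q)"
    by (auto simp: Legendre_def QuadRes_def split: if_splits)
  have "\<not> int q dvd s"
  proof
    assume "int q dvd s"
    then have "int q dvd s ^ 2" by (simp add: power2_eq_square)
    then have "int q dvd - 1 * (b ^ 2 + 1)" using s cong_dvd_iff by blast
    then show False using nz by (metis dvd_minus_iff mult_minus1)
  qed
  then obtain t where t: "[s * t = 1] (mod int q)"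
    using inverse_mod_prime[OF q(1)] by blast
  have "[t ^ 2 * s ^ 2 = t ^ 2 * (- 1 * (b ^ 2 + 1))] (mod int q)"
    by (rule cong_scalar_left[OF s])
  moreover have "[t ^ 2 * s ^ 2 = 1] (mod int q)"
    using cong_pow[OF t, of 2] by (simp add: power_mult_distrib mult.commute)
  ultimately have "[t ^ 2 * (- 1 * (b ^ 2 + 1)) = 1] (mod int q)"
    using cong_sym cong_trans by blast
  then have "[- (t ^ 2 * (- 1 * (b ^ 2 + 1))) = - 1] (mod int q)"
    by (simp only: cong_minus_minus_iff)
  then have "[(b * t) * (b * t) + t * t = - 1] (mod int q)"
    by (simp add: power2_eq_square algebra_simps)
  then show ?thesis by blast
qed

section \<open>Scalars, conjugation, norm and determinant in the field \<open>L\<close>\<close>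

locale paley_prime =
  fixes q n :: nat and L (structure)
  assumes prime_q: "prime q" and q_mod_4: "[q = 3] (mod 4)" and n_eq: "n = (q + 1) div 2"
  defines "L \<equiv> gauss_ring (int q)"
begin

lemma field_L: "field L"
  unfolding L_def by (rule field_gauss_ring[OF prime_q q_mod_4])

sublocale field L by (rule field_L)

lemma q_gt_2: "q > 2"
  by (rule gt_2_of_cong[OF q_mod_4])

lemma q_eq: "q + 1 = 2 * n" and even_n: "even n" and n_ge_2: "n \<ge> 2"
proof -
  have "q mod 4 = 3" using q_mod_4 by (simp add: cong_def)
  then show "q + 1 = 2 * n" "even n" "n \<ge> 2" unfolding n_eq by presburger+
qed

lemma carrier_L: "carrier L = {0..<int q} \<times> {0..<int q}"
  and mult_L: "x \<otimes> y = ((fst x * fst y - snd x * snd y) mod int q, (fst x * snd y + snd x * fst y) mod int q)"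
  and one_L: "\<one> = (1, 0)" and zero_L: "\<zero> = (0, 0)"
  by (simp_all add: L_def gauss_ring_def case_prod_beta)

text \<open>The embedding of the prime field into \<open>L\<close>, extended to all integers by
  reduction.\<close>

definition scalar :: "int \<Rightarrow> int \<times> int" where
  "scalar c = (c mod int q, 0)"

abbreviation conj :: "int \<times> int \<Rightarrow> int \<times> int" where
  "conj \<equiv> gauss_conj (int q)"

lemma scalar_carrier [simp, intro]: "scalar c \<in> carrier L"
  using q_gt_2 by (simp add: carrier_L scalar_def)

lemma scalar_mult: "scalar c \<otimes> x = (c * fst x mod int q, c * snd x mod int q)"
  by (simp add: mult_L scalar_def mod_simps)

lemma scalar_mult_scalar: "scalar c \<otimes> scalar d = scalar (c * d)"
  by (simp add: scalar_mult) (simp add: scalar_def mod_simps)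

lemma scalar_1 [simp]: "scalar 1 = \<one>"
  using q_gt_2 by (simp add: scalar_def one_L)

lemma scalar_cong: "scalar c = scalar d \<longleftrightarrow> [c = d] (mod int q)"
  by (simp add: scalar_def cong_def)

lemma scalar_minus_1: "scalar (- 1) = \<ominus> \<one>"
proof (rule minus_equality[symmetric])
  show "scalar (- 1) \<oplus> \<one> = \<zero>"
    using q_gt_2 by (simp add: L_def gauss_ring_simps scalar_def mod_simps)
qed auto

lemma conj_carrier [simp, intro]: "x \<in> carrier L \<Longrightarrow> conj x \<in> carrier L"
  using q_gt_2 by (auto simp: gauss_conj_def carrier_L)

lemma conj_conj [simp]: "x \<in> carrier L \<Longrightarrow> conj (conj x) = x"
  by (auto simp: gauss_conj_def carrier_L mod_simps)

lemma conj_mult: "conj (x \<otimes> y) = conj x \<otimes> conj y"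
proof -
  have "(fst x * fst y - (- snd x mod int q) * (- snd y mod int q)) mod int q =
      (fst x * fst y - (- snd x) * (- snd y)) mod int q"
    by (rule mod_diff_cong) (simp_all only: mod_mult_eq)
  moreover have "(fst x * (- snd y mod int q) + (- snd x mod int q) * fst y) mod int q =
      (fst x * (- snd y) + (- snd x) * fst y) mod int q"
    by (rule mod_add_cong) (simp_all only: mod_mult_right_eq mod_mult_left_eq)
  ultimately show ?thesis
    by (simp add: gauss_conj_def mult_L mod_minus_eq)
qed

lemma mult_conj: "x \<otimes> conj x = scalar (gauss_norm x)"
proof -
  have "(fst x * fst x - snd x * (- snd x mod int q)) mod int q =
      (fst x * fst x - snd x * (- snd x)) mod int q"
    by (rule mod_diff_cong) (simp_all only: mod_mult_right_eq)
  moreover have "(fst x * (- snd x mod int q) + snd x * fst x) mod int q =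
      (fst x * (- snd x) + snd x * fst x) mod int q"
    by (rule mod_add_cong) (simp_all only: mod_mult_right_eq)
  ultimately show ?thesis
    by (simp add: gauss_conj_def mult_L scalar_def gauss_norm_def)
qed

lemma conj_scalar [simp]: "conj (scalar c) = scalar c"
  by (simp add: gauss_conj_def scalar_def)

lemma norm_scalar: "[gauss_norm (scalar c) = c * c] (mod int q)"
  by (simp add: gauss_norm_def scalar_def cong_def mod_simps)

lemma norm_mult:
  assumes "x \<in> carrier L" "y \<in> carrier L"
  shows "[gauss_norm (x \<otimes> y) = gauss_norm x * gauss_norm y] (mod int q)"
proof -
  have "scalar (gauss_norm (x \<otimes> y)) = (x \<otimes> conj x) \<otimes> (y \<otimes> conj y)"
    unfolding mult_conj[symmetric] conj_mult using assms by (simp add: m_ac)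
  then show ?thesis by (simp add: mult_conj scalar_mult_scalar scalar_cong)
qed

text \<open>Multiplication by \<open>u\<close> is linear over the prime field, with determinant the
  norm of \<open>u\<close>.\<close>

lemma det_mult: "[gauss_det (u \<otimes> x) (u \<otimes> y) = gauss_norm u * gauss_det x y] (mod int q)"
proof -
  have "[gauss_det (u \<otimes> x) (u \<otimes> y) =
      (fst u * fst x - snd u * snd x) * (fst u * snd y + snd u * fst y)
      - (fst u * snd x + snd u * fst x) * (fst u * fst y - snd u * snd y)] (mod int q)"
    unfolding gauss_det_def mult_L fst_conv snd_conv
    by (intro cong_diff cong_mult) (simp_all add: cong_def)
  also have "(fst u * fst x - snd u * snd x) * (fst u * snd y + snd u * fst y)
      - (fst u * snd x + snd u * fst x) * (fst u * fst y - snd u * snd y) =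
      gauss_norm u * gauss_det x y"
    by (simp add: gauss_norm_def gauss_det_def algebra_simps)
  finally show ?thesis .
qed

text \<open>Conjugation is linear over the prime field, with determinant -1.\<close>

lemma det_conj: "[gauss_det (conj x) (conj y) = - gauss_det x y] (mod int q)"
proof -
  have "[gauss_det (conj x) (conj y) = fst x * (- snd y) - (- snd x) * fst y] (mod int q)"
    unfolding gauss_det_def gauss_conj_def fst_conv snd_conv
    by (intro cong_diff cong_mult) (simp_all add: cong_def)
  then show ?thesis by (simp add: gauss_det_def algebra_simps)
qed

subsection \<open>The dihedral action\<close>

lemma finite_L: "finite (carrier L)" and card_L: "card (carrier L) = q * q"
  by (simp_all add: carrier_L card_cartesian_product)

lemma norm_eq_1_imp: "x \<in> carrier L \<Longrightarrow> [gauss_norm x = 1] (mod int q) \<Longrightarrow> x \<otimes> conj x = \<one>"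
  by (metis mult_conj scalar_1 scalar_cong)

text \<open>For a primitive element g, the power z = g^(q-1) has order q + 1 = 2n, so z^n is the
  square root of 1 other than 1, and the norm of z is N(g)^(q-1) = 1 by Fermat. The doubled
  exponents in the last conclusion suit the projective line, where powers of z are compared only up
  to sign.\<close>

lemma exists_torus_generator:
  obtains z where "z \<in> carrier L" "[gauss_norm z = 1] (mod int q)" "z [^] n = \<ominus> \<one>"
    "\<And>i j. i < n \<Longrightarrow> j < n \<Longrightarrow> z [^] (2 * i) = z [^] (2 * j) \<Longrightarrow> i = j"
proof -
  interpret G: group "mult_of L" by (rule field_mult_group)
  obtain g where g: "g \<in> carrier (mult_of L)" "carrier (mult_of L) = {g [^] i | i::nat. i \<in> UNIV}"
    using finite_field_mult_group_has_gen[OF finite_L] by blast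
  have gL: "g \<in> carrier L" "g \<noteq> \<zero>" using g(1) by auto
  have fin: "finite (carrier (mult_of L))" using finite_L by simp
  have "G.ord g = card (carrier (mult_of L))"
    using G.generate_pow_card[OF g(1)] G.generate_pow_on_finite_carrier[OF fin g(1)] g(2)
    by (simp add: nat_pow_mult_of)
  also have "\<dots> = q * q - 1"
    using finite_L card_L by simp
  also have "\<dots> = (q - 1) * (2 * n)"
    using q_eq[symmetric] q_gt_2 by (cases q) auto
  finally have ord: "G.ord g = (q - 1) * (2 * n)" .
  define z where "z = g [^] (q - 1)"
  have z: "z \<in> carrier L" using gL by (simp add: z_def)
  have pow: "z [^] k = g [^]\<^bsub>mult_of L\<^esub> ((q - 1) * k)" for k :: nat
    using gL by (simp add: z_def nat_pow_pow nat_pow_mult_of)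
  have inj: "i = j" if "i < 2 * n" "j < 2 * n" "z [^] i = z [^] j" for i j
  proof -
    have "(q - 1) * i < (q - 1) * (2 * n)" "(q - 1) * j < (q - 1) * (2 * n)"
      using that q_gt_2 by auto
    then have "(q - 1) * i \<in> {0..G.ord g - 1}" "(q - 1) * j \<in> {0..G.ord g - 1}"
      unfolding ord atLeastAtMost_iff by linarith+
    then have "(q - 1) * i = (q - 1) * j"
      using that(3) unfolding pow by (intro inj_onD[OF G.ord_inj[OF g(1)]])
    then show ?thesis using q_gt_2 by simp
  qed
  have "z [^] (2 * n) = \<one>"
    using G.pow_ord_eq_1[OF g(1)] unfolding pow ord by simp
  then have "z [^] n \<otimes> z [^] n = \<one>"
    using z by (simp add: nat_pow_mult mult_2)
  moreover have "z [^] n \<noteq> \<one>"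
    using inj[of n 0] n_ge_2 z by auto
  ultimately have zn: "z [^] n = \<ominus> \<one>"
    using square_eq_one[of "z [^] n"] z by auto
  have "[gauss_norm (g [^] k) = gauss_norm g ^ k] (mod int q)" for k :: nat
  proof (induction k)
    case 0 show ?case by (simp add: gauss_norm_def one_L)
  next
    case (Suc k)
    have "[gauss_norm (g [^] k \<otimes> g) = gauss_norm (g [^] k) * gauss_norm g] (mod int q)"
      using gL by (intro norm_mult) auto
    also have "[gauss_norm (g [^] k) * gauss_norm g = gauss_norm g ^ k * gauss_norm g] (mod int q)"
      by (rule cong_scalar_right[OF Suc])
    finally show ?case by (simp add: mult.commute)
  qed
  then have "[gauss_norm z = gauss_norm g ^ (q - 1)] (mod int q)" by (simp add: z_def)
  moreover have "[gauss_norm g ^ (q - 1) = 1] (mod int q)"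
  proof -
    have "\<not> (int q dvd fst g \<and> int q dvd snd g)"
    proof -
      obtain a b where "g = (a, b)" by (cases g)
      then show ?thesis using gL by (auto simp: carrier_L zero_L dvd_eq_mod_eq_0)
    qed
    then have nd: "\<not> int q dvd gauss_norm g"
      unfolding gauss_norm_def using sum_squares_zero_mod[OF prime_q q_mod_4] by blast
    \<comment> \<open>Fermat's theorem is applied to a natural number; the norm is one, being a sum
      of squares.\<close>
    have nn: "gauss_norm g = int (nat (gauss_norm g))"
      by (simp add: gauss_norm_def)
    have "[nat (gauss_norm g) ^ (q - 1) = 1] (mod q)"
      using prime_q nd nn by (intro fermat_theorem) (metis int_dvd_int_iff)+
    then show ?thesis
      by (subst nn) (metis cong_int_iff of_nat_1 of_nat_power)
  qed
  ultimately have "[gauss_norm z = 1] (mod int q)" by (rule cong_trans)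
  moreover have "i = j" if "i < n" "j < n" "z [^] (2 * i) = z [^] (2 * j)" for i j
    using inj[of "2 * i" "2 * j"] that by simp
  ultimately show ?thesis using that[OF z _ zn] by blast
qed

section \<open>Fixed choices of \<open>zeta\<close> and \<open>omega\<close>, and the action up to
  sign\<close>

definition zeta :: "int \<times> int" where
  "zeta = (SOME z. z \<in> carrier L \<and> [gauss_norm z = 1] (mod int q) \<and> z [^] n = \<ominus> \<one> \<and>
     (\<forall>i<n. \<forall>j<n. z [^] (2 * i) = z [^] (2 * j) \<longrightarrow> i = j))"

lemma zeta: "zeta \<in> carrier L" "[gauss_norm zeta = 1] (mod int q)" "zeta [^] n = \<ominus> \<one>"
  "i < n \<Longrightarrow> j < n \<Longrightarrow> zeta [^] (2 * i) = zeta [^] (2 * j) \<Longrightarrow> i = j"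
proof -
  have "\<exists>z. z \<in> carrier L \<and> [gauss_norm z = 1] (mod int q) \<and> z [^] n = \<ominus> \<one> \<and>
     (\<forall>i<n. \<forall>j<n. z [^] (2 * i) = z [^] (2 * j) \<longrightarrow> i = j)"
    using exists_torus_generator by metis
  from someI_ex[OF this, folded zeta_def]
  show "zeta \<in> carrier L" "[gauss_norm zeta = 1] (mod int q)" "zeta [^] n = \<ominus> \<one>"
    "i < n \<Longrightarrow> j < n \<Longrightarrow> zeta [^] (2 * i) = zeta [^] (2 * j) \<Longrightarrow> i = j"
    by blast+
qed

text \<open>Norm -1 cancels the determinant -1 of conjugation, so that
  \<open>x \<mapsto> omega \<otimes> conj x\<close> has determinant 1.\<close>

definition omega :: "int \<times> int" where
  "omega = (SOME w. w \<in> carrier L \<and> [gauss_norm w = - 1] (mod int q))"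

lemma omega: "omega \<in> carrier L" "[gauss_norm omega = - 1] (mod int q)"
proof -
  obtain a b where "[a * a + b * b = - 1] (mod int q)"
    using exists_norm_minus_one[OF prime_q q_mod_4] by blast
  then have "(a mod int q, b mod int q) \<in> carrier L \<and>
      [gauss_norm (a mod int q, b mod int q) = - 1] (mod int q)"
    using q_gt_2 by (simp add: carrier_L gauss_norm_def cong_def mod_mult_mod_simps mod_simps)
  then have "\<exists>w. w \<in> carrier L \<and> [gauss_norm w = - 1] (mod int q)" by blast
  from someI_ex[OF this, folded omega_def]
  show "omega \<in> carrier L" "[gauss_norm omega = - 1] (mod int q)" by blast+
qed

lemma omega_nonzero: "omega \<noteq> \<zero>"
  using omega(2) q_gt_2 by (auto simp: gauss_norm_def zero_L cong_iff_dvd_diff)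

lemma zeta_pow_carrier [simp, intro]: "zeta [^] (k :: nat) \<in> carrier L"
  using zeta(1) by simp

lemma zeta_pow_mult_conj: "zeta [^] (k :: nat) \<otimes> conj (zeta [^] k) = \<one>"
proof (induction k)
  case 0 show ?case using q_gt_2 by (simp add: gauss_conj_def one_L mult_L)
next
  case (Suc k)
  have "zeta [^] Suc k \<otimes> conj (zeta [^] Suc k) =
      (zeta [^] k \<otimes> conj (zeta [^] k)) \<otimes> (zeta \<otimes> conj zeta)"
    using zeta(1) by (simp add: conj_mult m_ac)
  then show ?case using Suc zeta norm_eq_1_imp by simp
qed

lemma norm_zeta_pow: "[gauss_norm (zeta [^] (k :: nat)) = 1] (mod int q)"
  using zeta_pow_mult_conj[of k] unfolding mult_conj by (metis scalar_1 scalar_cong)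

lemma omega_mult_conj: "omega \<otimes> conj omega = \<ominus> \<one>"
  using omega(2) by (metis mult_conj scalar_cong scalar_minus_1)

definition act :: "nat \<times> bool \<Rightarrow> int \<times> int \<Rightarrow> int \<times> int" where
  "act g x = zeta [^] fst g \<otimes> (if snd g then omega \<otimes> conj x else x)"

lemma act_carrier [simp, intro]: "x \<in> carrier L \<Longrightarrow> act g x \<in> carrier L"
  using omega(1) by (auto simp: act_def)

lemma act_scalar:
  assumes "x \<in> carrier L"
  shows "act g (scalar c \<otimes> x) = scalar c \<otimes> act g x"
  using assms omega(1) by (auto simp: act_def conj_mult m_ac)

lemma det_act: "[gauss_det (act g x) (act g y) = gauss_det x y] (mod int q)"
proof -
  have z: "[gauss_det (zeta [^] fst g \<otimes> u) (zeta [^] fst g \<otimes> v) = gauss_det u v] (mod int q)" for u v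
    using cong_trans[OF det_mult cong_scalar_right[OF norm_zeta_pow]] by simp
  have "[gauss_det (omega \<otimes> conj x) (omega \<otimes> conj y) = - 1 * - gauss_det x y] (mod int q)"
    using cong_trans[OF det_mult cong_mult[OF omega(2) det_conj]] .
  then show ?thesis
    using cong_trans[OF z] by (auto simp: act_def)
qed

lemma act_nonzero:
  assumes "x \<in> carrier L" "x \<noteq> \<zero>"
  shows "act g x \<noteq> \<zero>"
proof -
  have "conj \<zero> = \<zero>" by (simp add: gauss_conj_def zero_L)
  then have conj0: "conj x \<noteq> \<zero>"
    using assms conj_conj by metis
  have "zeta [^] fst g \<noteq> \<zero>"
    using zeta_pow_mult_conj[of "fst g"] conj_carrier[OF zeta_pow_carrier] by auto
  then show ?thesis
    using assms conj0 omega(1) omega_nonzero by (auto simp: act_def integral_iff)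
qed

lemma zeta_pow_multiple: "\<exists>c\<in>{1, - 1}. zeta [^] (n * k) = scalar c"
proof (induction k)
  case 0 show ?case by simp
next
  case (Suc k)
  then obtain c where c: "c \<in> {1, -1}" "zeta [^] (n * k) = scalar c" by blast
  have "zeta [^] (n * Suc k) = zeta [^] (n * k) \<otimes> zeta [^] n"
    using zeta(1) by (simp add: nat_pow_mult add.commute)
  also have "\<dots> = scalar (c * - 1)"
    by (simp only: c(2) zeta(3) scalar_minus_1[symmetric] scalar_mult_scalar)
  finally show ?case using c(1) by force
qed

text \<open>The dihedral group reduces exponents modulo n, whereas zeta^n = -1; each wrap-around
  costs a sign.\<close>

lemma zeta_pow_mod: "\<exists>c\<in>{1, - 1}. zeta [^] (k mod n) = scalar c \<otimes> zeta [^] k"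
proof -
  obtain c where c: "c \<in> {1, -1}" "zeta [^] (n * (k div n)) = scalar c"
    using zeta_pow_multiple by blast
  have "zeta [^] k = scalar c \<otimes> zeta [^] (k mod n)"
    using zeta(1) c(2) by (metis nat_pow_mult mult_div_mod_eq)
  then have "scalar c \<otimes> zeta [^] k = (scalar c \<otimes> scalar c) \<otimes> zeta [^] (k mod n)"
    by (simp add: m_assoc)
  also have "scalar c \<otimes> scalar c = \<one>"
    using c(1) by (auto simp: scalar_mult_scalar)
  finally have "zeta [^] (k mod n) = scalar c \<otimes> zeta [^] k" by simp
  then show ?thesis using c(1) by blast
qed

text \<open>The dihedral product uses n - j for the exponent -j. The extra zeta^n is the sign -1,
  and conjugation inverts powers of \<open>zeta\<close> because they have norm 1.\<close>

lemma zeta_pow_reflect: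
  assumes "j < n"
  shows "zeta [^] (i + (n - j)) = scalar (- 1) \<otimes> (zeta [^] i \<otimes> conj (zeta [^] j))"
proof -
  have "zeta [^] (i + (n - j)) = zeta [^] (i + (n - j)) \<otimes> (zeta [^] j \<otimes> conj (zeta [^] j))"
    using zeta_pow_mult_conj by simp
  also have "\<dots> = zeta [^] (i + (n - j)) \<otimes> zeta [^] j \<otimes> conj (zeta [^] j)"
    by (simp add: m_assoc)
  also have "zeta [^] (i + (n - j)) \<otimes> zeta [^] j = zeta [^] i \<otimes> zeta [^] n"
    using zeta(1) assms by (simp add: nat_pow_mult)
  finally show ?thesis
    by (simp add: zeta(3) scalar_minus_1 m_ac)
qed

lemma act_mult:
  assumes "g \<in> carrier (dihedral_group n)" "h \<in> carrier (dihedral_group n)"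
  shows "\<exists>c\<in>{1, - 1}. \<forall>x\<in>carrier L. act (g \<otimes>\<^bsub>dihedral_group n\<^esub> h) x = scalar c \<otimes> act g (act h x)"
proof -
  obtain i s j t where gh: "g = (i, s)" "h = (j, t)" "i < n" "j < n"
    using assms by (auto simp: dihedral_group_def)
  define k where "k = (if s then i + (n - j) else i + j)"
  obtain c where c: "c \<in> {1, -1}" "zeta [^] (k mod n) = scalar c \<otimes> zeta [^] k"
    using zeta_pow_mod by blast
  \<comment> \<open>Besides the wrap-around sign \<open>c\<close>, a reflection followed by a
    rotation in the product picks up the -1 of \<open>zeta_pow_reflect\<close>. For two reflections
    this -1 cancels against omega times its conjugate, which is -1 as well.\<close>
  define d where "d = (if s then if t then c else - c else c)"
  have mult: "g \<otimes>\<^bsub>dihedral_group n\<^esub> h = (k mod n, s \<noteq> t)"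
    by (simp add: dihedral_group_def gh k_def)
  have "act (k mod n, s \<noteq> t) x = scalar d \<otimes> act g (act h x)" if x: "x \<in> carrier L" for x
  proof (cases s)
    case False
    then show ?thesis
      using x omega(1) zeta(1) c(2)
      by (simp add: gh act_def d_def k_def nat_pow_mult[symmetric] m_ac)
  next
    case s: True
    show ?thesis
    proof (cases t)
      case False
      have "act (k mod n, s \<noteq> t) x =
          scalar c \<otimes> scalar (- 1) \<otimes> (zeta [^] i \<otimes> conj (zeta [^] j) \<otimes> (omega \<otimes> conj x))"
        using False s x omega(1) c(2) zeta_pow_reflect[OF gh(4), of i]
        by (simp add: act_def k_def m_ac)
      also have "\<dots> = scalar d \<otimes> act g (act h x)"
        using False s x omega(1) by (simp add: gh act_def d_def scalar_mult_scalar conj_mult m_ac)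
      finally show ?thesis .
    next
      case True
      have "act g (act h x) = zeta [^] i \<otimes> conj (zeta [^] j) \<otimes> (omega \<otimes> conj omega) \<otimes> x"
        using True s x omega(1) by (simp add: gh act_def conj_mult m_ac)
      then have "scalar d \<otimes> act g (act h x) =
          scalar c \<otimes> (scalar (- 1) \<otimes> (zeta [^] i \<otimes> conj (zeta [^] j))) \<otimes> x"
        using True s x by (simp add: d_def omega_mult_conj scalar_minus_1 m_ac)
      also have "\<dots> = act (k mod n, s \<noteq> t) x"
        using True s c(2) zeta_pow_reflect[OF gh(4), of i] by (simp add: act_def k_def)
      finally show ?thesis by simp
    qed
  qed
  moreover have "d \<in> {1, -1}" using c(1) by (auto simp: d_def)
  ultimately show ?thesis unfolding mult by blast
qed

subsection \<open>The projective line\<close>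

text \<open>J = zeta^(n/2) squares to zeta^n = -1, so its inverse, which is its conjugate, equals
  -J. Moving J across the conjugation in the reflection therefore produces the sign.\<close>

lemma act_anticommute:
  assumes x: "x \<in> carrier L"
  shows "act (n div 2, False) (act (0, True) x) = scalar (- 1) \<otimes> act (0, True) (act (n div 2, False) x)"
proof -
  let ?J = "zeta [^] (n div 2)"
  have "n - n div 2 = n div 2" using even_n by auto
  moreover have "n div 2 < n" using n_ge_2 by simp
  ultimately have J: "?J = scalar (- 1) \<otimes> conj ?J"
    using zeta_pow_reflect[of "n div 2" 0] by simp
  have "act (n div 2, False) (act (0, True) x) = ?J \<otimes> (omega \<otimes> conj x)"
    using x omega(1) by (simp add: act_def)
  also have "\<dots> = (scalar (- 1) \<otimes> conj ?J) \<otimes> (omega \<otimes> conj x)"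
    using J by simp
  also have "\<dots> = scalar (- 1) \<otimes> act (0, True) (act (n div 2, False) x)"
    using x omega(1) by (simp add: act_def conj_mult m_ac)
  finally show ?thesis .
qed

section \<open>The quadratic character, and points as classes of proportional vectors\<close>

lemma chi_mult:
  assumes "\<not> int q dvd a" "\<not> int q dvd b"
  shows "chi q (a * b) = chi q a * chi q b"
  using assms Legendre_mult[OF prime_q q_gt_2 assms] q_gt_2 prime_q
  by (simp add: chi_eq_Legendre prime_dvd_mult_iff)

lemma chi_1: "chi q 1 = 1" and chi_minus_1: "chi q (- 1) = - 1"
proof -
  show "chi q (- 1) = - 1"
    using Legendre_minus_one[OF prime_q q_mod_4] q_gt_2 by (simp add: chi_eq_Legendre)
  show "chi q 1 = 1"
    using chi_mult[of "-1" "-1"] \<open>chi q (- 1) = - 1\<close> q_gt_2 by simp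
qed

lemma not_dvd_mult: "\<not> int q dvd a \<Longrightarrow> \<not> int q dvd b \<Longrightarrow> \<not> int q dvd a * b"
  using prime_q by (simp add: prime_dvd_mult_iff)

lemma scalar_eq_zero_iff: "scalar c = \<zero> \<longleftrightarrow> int q dvd c"
  by (auto simp: scalar_def zero_L)

abbreviation F :: "int ring" where "F \<equiv> residue_ring (int q)"

abbreviation X :: "(int \<times> int) set" where "X \<equiv> nonzero_pairs F"

lemma X_eq: "X = carrier L - {\<zero>}"
  by (auto simp: nonzero_pairs_def residue_ring_def carrier_L zero_L)

lemma scalar_X: "\<not> int q dvd c \<Longrightarrow> x \<in> X \<Longrightarrow> scalar c \<otimes> x \<in> X"
  by (auto simp: X_eq integral_iff scalar_eq_zero_iff)

lemma act_X: "x \<in> X \<Longrightarrow> act g x \<in> X"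
  using act_nonzero by (auto simp: X_eq)

lemma one_X: "\<one> \<in> X"
  by (simp add: X_eq)

text \<open>Allowing any integer prime to q as the factor lets factors be multiplied and inverted
  without reducing them.\<close>

lemma proportional_iff:
  "(x, y) \<in> proportional F \<longleftrightarrow> x \<in> X \<and> y \<in> X \<and> (\<exists>c. \<not> int q dvd c \<and> y = scalar c \<otimes> x)"
proof -
  have "(\<exists>c\<in>{0..int q - 1} - {0}. y = (c * fst x mod int q, c * snd x mod int q)) \<longleftrightarrow>
      (\<exists>c. \<not> int q dvd c \<and> y = scalar c \<otimes> x)"
  proof
    assume "\<exists>c\<in>{0..int q - 1} - {0}. y = (c * fst x mod int q, c * snd x mod int q)"
    then obtain c where c: "c \<in> {0..int q - 1} - {0}" "y = scalar c \<otimes> x"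
      unfolding scalar_mult by blast
    then have "\<not> int q dvd c" by (auto simp: dvd_eq_mod_eq_0)
    with c show "\<exists>c. \<not> int q dvd c \<and> y = scalar c \<otimes> x" by blast
  next
    assume "\<exists>c. \<not> int q dvd c \<and> y = scalar c \<otimes> x"
    then obtain c where c: "\<not> int q dvd c" "y = scalar c \<otimes> x" by blast
    have "y = scalar (c mod int q) \<otimes> x" using c(2) by (simp add: scalar_def)
    moreover have "c mod int q \<in> {0..int q - 1} - {0}"
      using c(1) q_gt_2 by (auto simp: dvd_eq_mod_eq_0)
    ultimately show "\<exists>c\<in>{0..int q - 1} - {0}. y = (c * fst x mod int q, c * snd x mod int q)"
      unfolding scalar_mult by blast
  qed
  then show ?thesis
    by (simp add: proportional_def residue_ring_def)
qed

lemma proportional_scalar: "x \<in> X \<Longrightarrow> \<not> int q dvd c \<Longrightarrow> (x, scalar c \<otimes> x) \<in> proportional F"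
  unfolding proportional_iff using scalar_X by blast

lemma equiv_proportional: "equiv X (proportional F)"
proof (rule equivI)
  show "proportional F \<subseteq> X \<times> X" by (auto simp: proportional_def)
  show "refl_on X (proportional F)"
  proof (rule refl_onI)
    fix x assume x: "x \<in> X"
    then have "scalar 1 \<otimes> x = x" by (simp add: X_eq)
    moreover have "\<not> int q dvd 1" using q_gt_2 by simp
    ultimately show "(x, x) \<in> proportional F"
      using proportional_scalar[OF x, of 1] by simp
  qed
  show "sym (proportional F)"
  proof (rule symI)
    fix x y assume "(x, y) \<in> proportional F"
    then obtain c where c: "x \<in> X" "y \<in> X" "\<not> int q dvd c" "y = scalar c \<otimes> x"
      unfolding proportional_iff by blast
    obtain d where d: "[c * d = 1] (mod int q)" using inverse_mod_prime[OF prime_q c(3)] .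
    have "scalar d \<otimes> y = (scalar c \<otimes> scalar d) \<otimes> x"
      using c(1) by (simp add: c(4) X_eq m_ac)
    also have "scalar c \<otimes> scalar d = \<one>"
      using d unfolding scalar_mult_scalar by (metis scalar_1 scalar_cong)
    finally have "x = scalar d \<otimes> y" using c(1) by (simp add: X_eq)
    moreover have "\<not> int q dvd d"
    proof
      assume "int q dvd d"
      then have "int q dvd 1" using d by (metis cong_dvd_iff dvd_mult)
      then show False using q_gt_2 by simp
    qed
    ultimately show "(y, x) \<in> proportional F"
      unfolding proportional_iff using c(1,2) by blast
  qed
  show "trans (proportional F)"
  proof (rule transI)
    fix x y z assume "(x, y) \<in> proportional F" "(y, z) \<in> proportional F"
    then obtain c d where c: "x \<in> X" "z \<in> X" "\<not> int q dvd c" "y = scalar c \<otimes> x"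
      and d: "\<not> int q dvd d" "z = scalar d \<otimes> y"
      unfolding proportional_iff by blast
    have "z = scalar (d * c) \<otimes> x"
      using c(1) by (simp add: c(4) d(2) X_eq m_assoc flip: scalar_mult_scalar)
    then show "(x, z) \<in> proportional F"
      unfolding proportional_iff using c d not_dvd_mult by blast
  qed
qed

definition cls :: "int \<times> int \<Rightarrow> (int \<times> int) set" where
  "cls x = proportional F `` {x}"

abbreviation P1 :: "(int \<times> int) set set" where "P1 \<equiv> projective_line F"

lemma cls_P1: "x \<in> X \<Longrightarrow> cls x \<in> P1"
  by (simp add: cls_def projective_line_def quotientI)

lemma P1_eq: "P1 = cls ` X"
  by (auto simp: cls_def projective_line_def quotient_def)

lemma cls_eq_iff: "x \<in> X \<Longrightarrow> y \<in> X \<Longrightarrow> cls x = cls y \<longleftrightarrow> (x, y) \<in> proportional F"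
  unfolding cls_def using eq_equiv_class_iff[OF equiv_proportional] by blast

lemma mem_P1:
  assumes "P \<in> P1" "x \<in> P"
  shows "x \<in> X" "cls x = P"
proof -
  obtain y where y: "y \<in> X" "P = cls y" using assms(1) unfolding P1_eq by blast
  then have yx: "(y, x) \<in> proportional F" using assms(2) by (simp add: cls_def)
  then show x: "x \<in> X" unfolding proportional_iff by blast
  show "cls x = P" using cls_eq_iff[OF y(1) x] yx y(2) by simp
qed

text \<open>The imaginary part of \<open>conj x \<otimes> y\<close> is the determinant. If it
  vanishes, the product is a scalar r, and multiplying by x gives N(x) y = r x with N(x) invertible.
  The converse is a direct computation.\<close>

lemma det_eq_0_iff:
  assumes x: "x \<in> X" and y: "y \<in> X"
  shows "int q dvd gauss_det x y \<longleftrightarrow> (x, y) \<in> proportional F"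
proof
  assume "(x, y) \<in> proportional F"
  then obtain c where "y = scalar c \<otimes> x" unfolding proportional_iff by blast
  then have "[gauss_det x y = fst x * (c * snd x) - snd x * (c * fst x)] (mod int q)"
    unfolding gauss_det_def scalar_mult fst_conv snd_conv
    by (simp only:) (intro cong_diff cong_mult; simp add: cong_def)
  then show "int q dvd gauss_det x y"
    by (simp add: algebra_simps cong_0_iff)
next
  assume det: "int q dvd gauss_det x y"
  let ?r = "fst x * fst y + snd x * snd y"
  have "(fst x * fst y - (- snd x mod int q) * snd y) mod int q =
      (fst x * fst y - (- snd x) * snd y) mod int q"
    by (rule mod_diff_cong) (simp_all only: mod_mult_left_eq)
  moreover have "(fst x * snd y + (- snd x mod int q) * fst y) mod int q =
      (fst x * snd y + (- snd x) * fst y) mod int q"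
    by (rule mod_add_cong) (simp_all only: mod_mult_left_eq)
  ultimately have "conj x \<otimes> y = scalar ?r"
    using det by (simp add: gauss_conj_def mult_L scalar_def gauss_det_def)
  then have "scalar ?r \<otimes> x = (x \<otimes> conj x) \<otimes> y"
    using x y by (simp add: X_eq m_ac)
  then have eq: "scalar (gauss_norm x) \<otimes> y = scalar ?r \<otimes> x"
    by (simp add: mult_conj)
  have "\<not> (int q dvd fst x \<and> int q dvd snd x)"
  proof -
    obtain a b where "x = (a, b)" by (cases x)
    then show ?thesis using x by (auto simp: X_eq carrier_L zero_L dvd_eq_mod_eq_0)
  qed
  then have "\<not> int q dvd gauss_norm x"
    unfolding gauss_norm_def using sum_squares_zero_mod[OF prime_q q_mod_4] by blast
  then obtain c where c: "[gauss_norm x * c = 1] (mod int q)"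
    using inverse_mod_prime[OF prime_q] by blast
  have "scalar (c * ?r) \<otimes> x = scalar c \<otimes> (scalar ?r \<otimes> x)"
    using x by (simp add: X_eq m_assoc flip: scalar_mult_scalar)
  also have "\<dots> = scalar (gauss_norm x * c) \<otimes> y"
    using y unfolding eq[symmetric] by (simp add: X_eq m_ac flip: scalar_mult_scalar)
  also have "scalar (gauss_norm x * c) = \<one>"
    using c by (metis scalar_1 scalar_cong)
  finally have y_eq: "y = scalar (c * ?r) \<otimes> x" using y by (simp add: X_eq)
  moreover have "\<not> int q dvd c * ?r"
  proof
    assume "int q dvd c * ?r"
    then have "scalar (c * ?r) = \<zero>" using scalar_eq_zero_iff by blast
    then have "y = \<zero>" using y_eq x by (simp add: X_eq)
    then show False using y by (simp add: X_eq)
  qed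
  ultimately show "(x, y) \<in> proportional F"
    unfolding proportional_iff using x y by blast
qed

text \<open>The images of 1 have norm 1 under rotations and -1 under reflections, and a scalar c
  multiplies the norm by c^2, which is never -1. So proportional images are of the same type with
  c^2 = 1; squaring removes c, and the powers zeta^(2i) with i < n are distinct.\<close>

lemma inj_on_orbit: "inj_on (\<lambda>g. cls (act g \<one>)) (carrier (dihedral_group n))"
proof (rule inj_onI)
  fix g h
  assume g: "g \<in> carrier (dihedral_group n)" and h: "h \<in> carrier (dihedral_group n)"
    and eq: "cls (act g \<one>) = cls (act h \<one>)"
  obtain i s j t where gh: "g = (i, s)" "h = (j, t)" "i < n" "j < n"
    using g h by (auto simp: dihedral_group_def)
  have "(act g \<one>, act h \<one>) \<in> proportional F"
    using eq cls_eq_iff act_X one_X by simp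
  then obtain c where c: "act h \<one> = scalar c \<otimes> act g \<one>"
    unfolding proportional_iff by blast
  have conj1: "conj \<one> = \<one>" using conj_scalar[of 1] by simp
  define u where "u b = (if b then omega else \<one>)" for b
  have u: "u b \<in> carrier L" "u b \<noteq> \<zero>" for b
    using omega(1) omega_nonzero by (auto simp: u_def)
  have act1: "act (k, b) \<one> = zeta [^] k \<otimes> u b" for k b
    using omega(1) by (simp add: act_def conj1 u_def)
  have norm_u: "[gauss_norm (u b) = (if b then - 1 else 1)] (mod int q)" for b
    using omega(2) by (simp add: u_def gauss_norm_def one_L)
  have norm_act: "[gauss_norm (act (k, b) \<one>) = (if b then - 1 else 1)] (mod int q)" for k b
    unfolding act1
    using cong_trans[OF norm_mult[OF zeta_pow_carrier u(1)] cong_mult[OF norm_zeta_pow norm_u]]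
    by simp
  have "[gauss_norm (act h \<one>) = c * c * (if s then - 1 else 1)] (mod int q)"
    unfolding c
    using cong_trans[OF norm_mult[OF scalar_carrier act_carrier[OF one_closed]]
        cong_mult[OF norm_scalar norm_act[of i s]]] gh(1) by simp
  then have cc: "[c * c * (if s then - 1 else 1) = (if t then - 1 else 1)] (mod int q)"
    using norm_act[of j t] gh(2) cong_sym cong_trans by blast
  have nres: "\<not> [c * c = - 1] (mod int q)"
  proof
    assume "[c * c = - 1] (mod int q)"
    then have "QuadRes (int q) (- 1)" unfolding QuadRes_def power2_eq_square by blast
    then show False using Legendre_minus_one[OF prime_q q_mod_4]
      by (simp add: Legendre_def split: if_splits)
  qed
  have minus: "[c * c = - 1] (mod int q) \<longleftrightarrow> [- (c * c) = 1] (mod int q)"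
    using cong_minus_minus_iff[of "c * c" "- 1" "int q"] by simp
  have st: "s = t"
    using cc nres minus by (cases s; cases t) auto
  then have c1: "[c * c = 1] (mod int q)"
    using cc cong_minus_minus_iff[of "c * c" 1 "int q"] by (cases t) auto
  have "zeta [^] j \<otimes> u t = (scalar c \<otimes> zeta [^] i) \<otimes> u t"
    using c u(1) unfolding gh act1 st by (simp add: m_assoc)
  then have "zeta [^] j = scalar c \<otimes> zeta [^] i"
    using m_rcancel[OF u(2) u(1)] by simp
  then have "zeta [^] j \<otimes> zeta [^] j = (scalar c \<otimes> scalar c) \<otimes> (zeta [^] i \<otimes> zeta [^] i)"
    by (simp add: m_ac)
  also have "scalar c \<otimes> scalar c = \<one>"
    using c1 unfolding scalar_mult_scalar by (metis scalar_1 scalar_cong)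
  finally have "zeta [^] (2 * j) = zeta [^] (2 * i)"
    using zeta(1) by (simp add: nat_pow_mult mult_2)
  then have "j = i" using zeta(4) gh by blast
  then show "g = h" using gh st by simp
qed

text \<open>The orbit of 1 supplies the matching lower bound afterwards.\<close>

lemma card_P1_le: "finite P1" "card P1 \<le> q + 1"
proof -
  \<comment> \<open>Representatives of all points: the point at infinity (0, 1) and the affine
    points (1, b).\<close>
  let ?S = "insert (0, 1) (Pair (1 :: int) ` {0..<int q})"
  have "P1 \<subseteq> cls ` ?S"
  proof
    fix P assume "P \<in> P1"
    then obtain a b where ab: "(a, b) \<in> X" "P = cls (a, b)" unfolding P1_eq by auto
    then have range: "a \<in> {0..<int q}" "b \<in> {0..<int q}" "(a, b) \<noteq> (0, 0)"
      by (auto simp: X_eq carrier_L zero_L)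
    show "P \<in> cls ` ?S"
    proof (cases "a = 0")
      case True
      then have "(a, b) = scalar b \<otimes> (0, 1)" "\<not> int q dvd b"
        using range by (auto simp: scalar_mult dvd_eq_mod_eq_0)
      moreover have "(0, 1) \<in> X" using q_gt_2 by (simp add: X_eq carrier_L zero_L)
      ultimately have "cls (0, 1) = P"
        using proportional_scalar[of "(0, 1)" b] cls_eq_iff[OF _ ab(1)] ab(2) by simp
      then show ?thesis by blast
    next
      case False
      then have "\<not> int q dvd a" using range by (auto simp: dvd_eq_mod_eq_0)
      then obtain c where c: "[a * c = 1] (mod int q)" using inverse_mod_prime[OF prime_q] by blast
      have nd: "\<not> int q dvd c"
      proof
        assume "int q dvd c"
        then have "int q dvd 1" using c by (metis cong_dvd_iff dvd_mult)
        then show False using q_gt_2 by simp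
      qed
      have "scalar c \<otimes> (a, b) = (1, c * b mod int q)"
        using c q_gt_2 by (simp add: scalar_mult cong_def mult.commute)
      then have "P = cls (1, c * b mod int q)"
        using proportional_scalar[OF ab(1) nd] cls_eq_iff[OF ab(1) scalar_X[OF nd ab(1)]] ab(2)
        by simp
      moreover have "c * b mod int q \<in> {0..<int q}" using q_gt_2 by simp
      ultimately show ?thesis by blast
    qed
  qed
  moreover have "finite ?S" by simp
  moreover have "card ?S \<le> q + 1"
    using card_image_le[of "{0..<int q}" "Pair (1 :: int)"] by (simp add: card_insert_if)
  ultimately show "finite P1" "card P1 \<le> q + 1"
    by (meson finite_surj, meson card_image_le card_mono finite_imageI le_trans)
qed

text \<open>The orbit has 2n = q + 1 distinct points, and the line has at most q + 1.\<close>

lemma bij_betw_orbit: "bij_betw (\<lambda>g. cls (act g \<one>)) (carrier (dihedral_group n)) P1"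
  and card_P1: "card P1 = 2 * n"
proof -
  let ?f = "\<lambda>g. cls (act g \<one>)" and ?D = "carrier (dihedral_group n)"
  have sub: "?f ` ?D \<subseteq> P1"
    using cls_P1 act_X one_X by blast
  have "card (?f ` ?D) = 2 * n"
    using card_image[OF inj_on_orbit] dihedral_order[of n] by (simp add: Coset.order_def)
  then have eq: "card (?f ` ?D) = card P1 \<and> card P1 = 2 * n"
    using card_mono[OF card_P1_le(1) sub] card_P1_le(2) q_eq by linarith
  then show "card P1 = 2 * n" by blast
  show "bij_betw ?f ?D P1"
    using card_subset_eq[OF card_P1_le(1) sub] eq inj_on_orbit by (simp add: bij_betw_def)
qed

end

section \<open>The projective representation\<close>

lemma gram_smult:
  assumes "v \<in> carrier_vec m" "w \<in> carrier_vec m" "f i = a \<cdot>\<^sub>v v" "f j = b \<cdot>\<^sub>v w"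
  shows "gram f i j = cnj a * b * (w \<bullet>c v)"
  using assms by (simp add: gram_def cscalar_prod_sum[of _ m] sum_distrib_left mult_ac)

lemma smult_mat_mult_vec:
  fixes A :: "complex mat"
  assumes "A \<in> carrier_mat k m" "v \<in> carrier_vec m"
  shows "(c \<cdot>\<^sub>m A) *\<^sub>v v = c \<cdot>\<^sub>v (A *\<^sub>v v)"
  using assms by (auto simp: scalar_prod_def sum_distrib_left mult_ac intro!: eq_vecI sum.cong)

lemma smult_mat_mult_smult_mat:
  fixes A B :: "complex mat"
  assumes A: "A \<in> carrier_mat n n" and B: "B \<in> carrier_mat n n"
  shows "(a \<cdot>\<^sub>m A) * (b \<cdot>\<^sub>m B) = (a * b) \<cdot>\<^sub>m (A * B)"
proof -
  have "(a \<cdot>\<^sub>m A) * (b \<cdot>\<^sub>m B) = a \<cdot>\<^sub>m (b \<cdot>\<^sub>m (A * B))"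
    using mult_smult_assoc_mat[OF A smult_carrier_mat[OF B]] mult_smult_distrib[OF A B] by simp
  also have "\<dots> = (a * b) \<cdot>\<^sub>m (A * B)"
    by (rule eq_matI) auto
  finally show ?thesis .
qed

section \<open>The frame extended to all nonzero vectors, and its Gram matrix\<close>

locale paley_config = paley_prime +
  fixes rep :: "(int \<times> int) set \<Rightarrow> int \<times> int" and \<Phi> :: "(int \<times> int) set \<Rightarrow> complex vec"
  assumes rep: "representatives F rep" and etf: "paley_etf q rep \<Phi>"
begin

lemma rep_mem: "P \<in> P1 \<Longrightarrow> rep P \<in> P"
  using rep by (simp add: representatives_def)

lemma rep_X: "P \<in> P1 \<Longrightarrow> rep P \<in> X" and cls_rep: "P \<in> P1 \<Longrightarrow> cls (rep P) = P"
  using mem_P1 rep_mem by blast+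

lemma Phi_carrier: "P \<in> P1 \<Longrightarrow> \<Phi> P \<in> carrier_vec n"
  and Phi_unit: "P \<in> P1 \<Longrightarrow> \<Phi> P \<bullet>c \<Phi> P = 1"
  using etf unfolding paley_etf_def Let_def unit_vector_def n_eq by auto

lemma gram_Phi:
  assumes "P \<in> P1" "Q \<in> P1"
  shows "gram \<Phi> P Q = (if P = Q then 1 else
    \<i> / of_real (sqrt (real q)) * of_int (chi q (gauss_det (rep P) (rep Q))))"
proof (cases "P = Q")
  case True
  then show ?thesis using Phi_unit assms by (simp add: gram_def)
next
  case False
  have res: "residues (int q)"
    using q_gt_2 by (simp add: residues_def)
  \<comment> \<open>The determinant over the residue ring is the integer determinant reduced modulo
    q, and \<open>chi\<close> reduces its argument in the same way.\<close>
  have "det2 F x y = gauss_det x y mod int q" for x y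
    by (simp add: det2_def gauss_det_def a_minus_def residues.res_mult_eq[OF res]
        residues.res_add_eq[OF res] residues.res_neg_eq[OF res] mod_simps)
  then have "paley_matrix F rep P Q = chi q (gauss_det (rep P) (rep Q))"
    by (simp add: paley_matrix_def chi_def)
  then show ?thesis
    using etf assms False unfolding paley_etf_def Let_def by simp
qed

text \<open>The factor is determined only modulo q, which is all that \<open>chi\<close>
  sees.\<close>

definition coef :: "int \<times> int \<Rightarrow> int" where
  "coef x = (SOME c. \<not> int q dvd c \<and> x = scalar c \<otimes> rep (cls x))"

text \<open>The extension of \<open>\<Phi>\<close> that is homogeneous with respect to the quadratic
  character. It lives on vectors, where \<open>act\<close> is defined, and so keeps track of the
  signs that points forget.\<close>

definition ext :: "int \<times> int \<Rightarrow> complex vec" where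
  "ext x = of_int (chi q (coef x)) \<cdot>\<^sub>v \<Phi> (cls x)"

lemma coef:
  assumes "x \<in> X"
  shows "\<not> int q dvd coef x" "x = scalar (coef x) \<otimes> rep (cls x)"
proof -
  have P: "cls x \<in> P1" using cls_P1 assms by blast
  have "(rep (cls x), x) \<in> proportional F"
    using cls_eq_iff[OF rep_X[OF P] assms] cls_rep[OF P] by simp
  then have "\<exists>c. \<not> int q dvd c \<and> x = scalar c \<otimes> rep (cls x)"
    unfolding proportional_iff by blast
  from someI_ex[OF this, folded coef_def]
  show "\<not> int q dvd coef x" "x = scalar (coef x) \<otimes> rep (cls x)" by blast+
qed

lemma chi_coef_unique:
  assumes x: "x \<in> X" and eq: "x = scalar c \<otimes> rep (cls x)"
  shows "chi q (coef x) = chi q c"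
proof -
  have r: "rep (cls x) \<in> X" using rep_X cls_P1 x by blast
  have "scalar (coef x) \<otimes> rep (cls x) = scalar c \<otimes> rep (cls x)"
    using eq coef(2)[OF x] by simp
  then have "scalar (coef x) = scalar c"
    using r m_rcancel[of "rep (cls x)"] by (simp add: X_eq)
  then show ?thesis unfolding scalar_cong by (rule chi_cong)
qed

lemma ext_carrier: "x \<in> X \<Longrightarrow> ext x \<in> carrier_vec n"
  using Phi_carrier cls_P1 by (simp add: ext_def)

lemma ext_scalar:
  assumes x: "x \<in> X" and c: "\<not> int q dvd c"
  shows "ext (scalar c \<otimes> x) = of_int (chi q c) \<cdot>\<^sub>v ext x"
proof -
  have cls: "cls (scalar c \<otimes> x) = cls x"
    using cls_eq_iff[OF x scalar_X[OF c x]] proportional_scalar[OF x c] by simp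
  have r: "rep (cls x) \<in> X" using rep_X cls_P1 x by blast
  have "scalar c \<otimes> x = scalar c \<otimes> (scalar (coef x) \<otimes> rep (cls x))"
    using coef(2)[OF x] by simp
  also have "\<dots> = scalar (c * coef x) \<otimes> rep (cls (scalar c \<otimes> x))"
    using r by (simp add: cls X_eq m_assoc flip: scalar_mult_scalar)
  finally have "chi q (coef (scalar c \<otimes> x)) = chi q (c * coef x)"
    by (rule chi_coef_unique[OF scalar_X[OF c x]])
  then have "chi q (coef (scalar c \<otimes> x)) = chi q c * chi q (coef x)"
    using chi_mult[OF c coef(1)[OF x]] by simp
  then show ?thesis by (simp add: ext_def cls smult_smult_assoc)
qed

lemma ext_rep:
  assumes P: "P \<in> P1"
  shows "ext (rep P) = \<Phi> P"
proof -
  have "rep P = scalar 1 \<otimes> rep (cls (rep P))"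
    using rep_X[OF P] by (simp add: cls_rep[OF P] X_eq)
  then have "chi q (coef (rep P)) = 1"
    using chi_coef_unique[OF rep_X[OF P], of 1] chi_1 by simp
  then show ?thesis by (simp add: ext_def cls_rep[OF P])
qed

text \<open>There are two cases because \<open>chi\<close> is 1 at 0, so the determinant formula
  fails for proportional vectors. For the others the determinant scales by both coefficients, and
  \<open>chi\<close> is multiplicative on nonzero arguments.\<close>

lemma gram_ext:
  assumes x: "x \<in> X" and y: "y \<in> X"
  shows "\<not> int q dvd c \<Longrightarrow> y = scalar c \<otimes> x \<Longrightarrow> gram ext x y = of_int (chi q c)"
    and "(x, y) \<notin> proportional F \<Longrightarrow>
      gram ext x y = \<i> / of_real (sqrt (real q)) * of_int (chi q (gauss_det x y))"
proof -
  have P: "cls x \<in> P1" "cls y \<in> P1" using cls_P1 x y by blast+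
  have gram: "gram ext u v = of_int (chi q (coef u) * chi q (coef v)) * gram \<Phi> (cls u) (cls v)"
    if "u \<in> X" "v \<in> X" for u v
    using gram_smult[OF Phi_carrier[OF cls_P1[OF that(1)]] Phi_carrier[OF cls_P1[OF that(2)]],
        of ext u "of_int (chi q (coef u))" v "of_int (chi q (coef v))"]
    by (simp add: ext_def gram_def)
  show "gram ext x y = of_int (chi q c)" if c: "\<not> int q dvd c" "y = scalar c \<otimes> x"
  proof -
    have "gram ext x x = 1"
      using gram[OF x x] gram_Phi[OF P(1) P(1)] chi_range[of q "coef x"] by auto
    moreover have "gram ext x y = cnj 1 * of_int (chi q c) * (ext x \<bullet>c ext x)"
      using ext_scalar[OF x c(1)] c(2)
      by (intro gram_smult[OF ext_carrier[OF x] ext_carrier[OF x]]) auto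
    ultimately show ?thesis by (simp add: gram_def)
  qed
  show "gram ext x y = \<i> / of_real (sqrt (real q)) * of_int (chi q (gauss_det x y))"
    if np: "(x, y) \<notin> proportional F"
  proof -
    let ?r = "rep (cls x)" and ?s = "rep (cls y)"
    have ne: "cls x \<noteq> cls y" using np cls_eq_iff[OF x y] by simp
    have rX: "?r \<in> X" "?s \<in> X" using rep_X P by auto
    have "(?r, ?s) \<notin> proportional F"
      using ne cls_eq_iff[OF rX] cls_rep P by simp
    then have nd: "\<not> int q dvd gauss_det ?r ?s" using det_eq_0_iff[OF rX] by simp
    have "[gauss_det x y = gauss_det (scalar (coef x) \<otimes> ?r) (scalar (coef y) \<otimes> ?s)] (mod int q)"
      using coef(2)[OF x] coef(2)[OF y] by simp
    also have "[gauss_det (scalar (coef x) \<otimes> ?r) (scalar (coef y) \<otimes> ?s) =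
        (coef x * fst ?r) * (coef y * snd ?s) - (coef x * snd ?r) * (coef y * fst ?s)] (mod int q)"
      unfolding gauss_det_def scalar_mult fst_conv snd_conv
      by (intro cong_diff cong_mult) (simp_all add: cong_def)
    also have "(coef x * fst ?r) * (coef y * snd ?s) - (coef x * snd ?r) * (coef y * fst ?s) =
        (coef x * coef y) * gauss_det ?r ?s"
      by (simp add: gauss_det_def algebra_simps)
    finally have "chi q (gauss_det x y) = chi q ((coef x * coef y) * gauss_det ?r ?s)"
      by (rule chi_cong)
    also have "\<dots> = chi q (coef x) * chi q (coef y) * chi q (gauss_det ?r ?s)"
      using coef(1)[OF x] coef(1)[OF y] nd by (simp add: chi_mult not_dvd_mult)
    finally show ?thesis
      using gram[OF x y] gram_Phi[OF P] ne by simp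
  qed
qed

text \<open>Both expressions in \<open>gram_ext\<close> are invariant: \<open>act\<close> commutes
  with scalars and preserves determinants modulo q, hence also non-proportionality.\<close>

lemma gram_ext_act:
  assumes x: "x \<in> X" and y: "y \<in> X"
  shows "gram (\<lambda>u. ext (act g u)) x y = gram ext x y"
proof -
  have comp: "gram (\<lambda>u. ext (act g u)) x y = gram ext (act g x) (act g y)"
    by (simp add: gram_def)
  have act: "act g x \<in> X" "act g y \<in> X" using act_X x y by auto
  show ?thesis
  proof (cases "(x, y) \<in> proportional F")
    case True
    then obtain c where c: "\<not> int q dvd c" "y = scalar c \<otimes> x"
      unfolding proportional_iff by blast
    then have "act g y = scalar c \<otimes> act g x"
      using act_scalar x by (simp add: X_eq)
    then show ?thesis
      using gram_ext(1)[OF x y c] gram_ext(1)[OF act c(1)] comp by simp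
  next
    case False
    have "int q dvd gauss_det (act g x) (act g y) \<longleftrightarrow> int q dvd gauss_det x y"
      using cong_dvd_iff[OF det_act] .
    then have "(act g x, act g y) \<notin> proportional F"
      using False det_eq_0_iff[OF x y] det_eq_0_iff[OF act] by blast
    then show ?thesis
      using gram_ext(2)[OF x y False] gram_ext(2)[OF act] chi_cong[OF det_act[of g x y]] comp
      by simp
  qed
qed

text \<open>Each row of the Gram matrix has one entry of modulus 1 and q entries of squared modulus
  1/q, so its squared moduli sum to 2. The frame potential is thus 4n, the minimum for 2n unit
  vectors in dimension n.\<close>

lemma tight_of_gram:
  assumes dim: "\<And>P. P \<in> P1 \<Longrightarrow> f P \<in> carrier_vec n"
    and gram: "\<And>P Q. P \<in> P1 \<Longrightarrow> Q \<in> P1 \<Longrightarrow> gram f P Q = gram \<Phi> P Q"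
  shows "tight n P1 f"
proof -
  have q0: "complex_of_nat q \<noteq> 0" using q_gt_2 by simp
  have sqrt: "complex_of_real (sqrt (real q)) * complex_of_real (sqrt (real q)) = of_nat q"
    by (simp flip: of_real_mult)
  have abs2: "gram f P Q * cnj (gram f P Q) = (if P = Q then 1 else 1 / of_nat q)"
    if "P \<in> P1" "Q \<in> P1" for P Q
    using chi_range[of q "gauss_det (rep P) (rep Q)"] sqrt q0
    by (auto simp: gram[OF that] gram_Phi[OF that])
  have row: "(\<Sum>Q\<in>P1. gram f P Q * cnj (gram f P Q)) = 2" if P: "P \<in> P1" for P
  proof -
    have "(\<Sum>Q\<in>P1. gram f P Q * cnj (gram f P Q)) =
        1 + (\<Sum>Q\<in>P1 - {P}. gram f P Q * cnj (gram f P Q))"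
      using abs2[OF P P] by (simp add: sum.remove[OF card_P1_le(1) P])
    also have "(\<Sum>Q\<in>P1 - {P}. gram f P Q * cnj (gram f P Q)) = (\<Sum>Q\<in>P1 - {P}. 1 / of_nat q)"
      using abs2[OF P] by (intro sum.cong refl) auto
    also have "\<dots> = 1"
      using P card_P1 q_eq q0 by (simp add: card_Diff_singleton flip: q_eq)
    finally show ?thesis by simp
  qed
  have "(\<Sum>P\<in>P1. gram f P P) = (\<Sum>P\<in>P1. 1)"
    using gram gram_Phi by (intro sum.cong refl) auto
  then have c: "of_nat n * 2 = (\<Sum>P\<in>P1. gram f P P)"
    using card_P1 by simp
  have pot: "(\<Sum>P\<in>P1. \<Sum>Q\<in>P1. gram f P Q * cnj (gram f P Q)) = of_nat n * 2 * cnj 2"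
    using row card_P1 by simp
  show ?thesis
    unfolding tight_def
    using tight_of_frame_potential[OF card_P1_le(1) dim c pot] card_P1_le(1) dim by blast
qed

lemma tight_Phi: "tight n P1 \<Phi>"
  using Phi_carrier by (intro tight_of_gram) auto

section \<open>The unitaries that lift the dihedral action\<close>

definition rho :: "nat \<times> bool \<Rightarrow> complex mat" where
  "rho g = (SOME U. unitary n U \<and> (\<forall>P\<in>P1. U *\<^sub>v \<Phi> P = ext (act g (rep P))))"

text \<open>By \<open>gram_ext_act\<close> the moved frame has the Gram matrix of
  \<open>\<Phi>\<close>, hence is tight as well, and \<open>unitary_of_equal_gram\<close> provides
  the unitary.\<close>

lemma rho: "unitary n (rho g)" "P \<in> P1 \<Longrightarrow> rho g *\<^sub>v \<Phi> P = ext (act g (rep P))"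
proof -
  let ?f = "\<lambda>P. ext (act g (rep P))"
  have dim: "?f P \<in> carrier_vec n" if "P \<in> P1" for P
    using ext_carrier act_X rep_X that by blast
  have gram: "gram ?f P Q = gram \<Phi> P Q" if "P \<in> P1" "Q \<in> P1" for P Q
  proof -
    have "gram ?f P Q = gram (\<lambda>u. ext (act g u)) (rep P) (rep Q)" by (simp add: gram_def)
    also have "\<dots> = gram ext (rep P) (rep Q)" by (intro gram_ext_act rep_X that)
    also have "\<dots> = gram \<Phi> P Q" using that by (simp add: gram_def ext_rep)
    finally show ?thesis .
  qed
  have tight: "tight n P1 ?f" using tight_of_gram[OF dim gram] .
  have "\<exists>U. unitary n U \<and> (\<forall>P\<in>P1. U *\<^sub>v \<Phi> P = ?f P)"
    by (rule unitary_of_equal_gram[OF tight_Phi tight gram[symmetric]]) blast+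
  from someI_ex[OF this, folded rho_def]
  show "unitary n (rho g)" "P \<in> P1 \<Longrightarrow> rho g *\<^sub>v \<Phi> P = ext (act g (rep P))" by blast+
qed

lemma rho_carrier [simp]: "rho g \<in> carrier_mat n n"
  using rho(1)[of g] by (simp add: unitary_def)

text \<open>Homogeneity of \<open>ext\<close> and linearity of \<open>act\<close> over scalars carry
  the defining property from the representatives to all nonzero vectors.\<close>

lemma rho_ext:
  assumes x: "x \<in> X"
  shows "rho g *\<^sub>v ext x = ext (act g x)"
proof -
  have P: "cls x \<in> P1" using cls_P1 x by blast
  have "rho g *\<^sub>v ext x = of_int (chi q (coef x)) \<cdot>\<^sub>v ext (act g (rep (cls x)))"
    using mult_mat_vec[OF rho_carrier Phi_carrier[OF P]] rho(2)[OF P] by (simp add: ext_def)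
  also have "\<dots> = ext (scalar (coef x) \<otimes> act g (rep (cls x)))"
    using ext_scalar[OF act_X[OF rep_X[OF P]] coef(1)[OF x]] by simp
  also have "\<dots> = ext (act g (scalar (coef x) \<otimes> rep (cls x)))"
    using act_scalar rep_X[OF P] by (simp add: X_eq)
  also have "\<dots> = ext (act g x)" using coef(2)[OF x] by simp
  finally show ?thesis .
qed

text \<open>Operators on \<open>\<complex>\<^sup>n\<close> are determined by their values on the frame, so relations between
  the maps \<^const>\<open>act\<close> lift to \<^const>\<open>rho\<close>, a sign \<open>c\<close> becoming \<open>chi q c = c\<close>.\<close>

lemma rho_eqI:
  assumes c: "c \<in> {1, - 1}" and A: "A \<in> carrier_mat n n" and B: "B \<in> carrier_mat n n"
    and a: "\<And>x. x \<in> X \<Longrightarrow> a x \<in> X" and b: "\<And>x. x \<in> X \<Longrightarrow> b x = scalar c \<otimes> a x"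
    and Aa: "\<And>x. x \<in> X \<Longrightarrow> A *\<^sub>v ext x = ext (a x)" and Bb: "\<And>x. x \<in> X \<Longrightarrow> B *\<^sub>v ext x = ext (b x)"
  shows "B = of_int c \<cdot>\<^sub>m A"
proof (rule tight_mat_eqI[OF tight_Phi B])
  show "of_int c \<cdot>\<^sub>m A \<in> carrier_mat n n" using A by simp
  fix P assume P: "P \<in> P1"
  have nd: "\<not> int q dvd c" and chi: "chi q c = c"
    using c q_gt_2 chi_1 chi_minus_1 by auto
  have r: "rep P \<in> X" using rep_X[OF P] .
  have "B *\<^sub>v ext (rep P) = of_int (chi q c) \<cdot>\<^sub>v ext (a (rep P))"
    using Bb[OF r] b[OF r] ext_scalar[OF a[OF r] nd] by simp
  also have "\<dots> = (of_int c \<cdot>\<^sub>m A) *\<^sub>v ext (rep P)"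
    using smult_mat_mult_vec[OF A ext_carrier[OF r]] Aa[OF r] chi by simp
  finally show "B *\<^sub>v \<Phi> P = (of_int c \<cdot>\<^sub>m A) *\<^sub>v \<Phi> P"
    by (simp add: ext_rep[OF P])
qed

lemma rho_rho_ext: "x \<in> X \<Longrightarrow> (rho g * rho h) *\<^sub>v ext x = ext (act g (act h x))"
  using assoc_mult_mat_vec[OF rho_carrier rho_carrier ext_carrier] by (simp add: rho_ext act_X)

lemma projective_rho: "projective_unitary_rep (dihedral_group n) n rho"
  unfolding projective_unitary_rep_def
proof (intro conjI ballI)
  fix g h assume gh: "g \<in> carrier (dihedral_group n)" "h \<in> carrier (dihedral_group n)"
  obtain c where c: "c \<in> {1, -1}"
      "\<forall>x\<in>carrier L. act (g \<otimes>\<^bsub>dihedral_group n\<^esub> h) x = scalar c \<otimes> act g (act h x)"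
    using act_mult[OF gh] by blast
  have "rho (g \<otimes>\<^bsub>dihedral_group n\<^esub> h) = of_int c \<cdot>\<^sub>m (rho g * rho h)"
  proof (rule rho_eqI[where a = "\<lambda>x. act g (act h x)" and b = "act (g \<otimes>\<^bsub>dihedral_group n\<^esub> h)"])
    show "rho g * rho h \<in> carrier_mat n n" by (rule mult_carrier_mat[OF rho_carrier rho_carrier])
    fix x assume x: "x \<in> X"
    then show "act (g \<otimes>\<^bsub>dihedral_group n\<^esub> h) x = scalar c \<otimes> act g (act h x)"
      using c(2) by (simp add: X_eq)
    show "act g (act h x) \<in> X" using act_X x by blast
  qed (use c(1) in \<open>simp_all add: rho_ext rho_rho_ext\<close>)
  moreover have "cmod (of_int c) = 1" using c(1) by auto
  ultimately show "\<exists>c. cmod c = 1 \<and> rho (g \<otimes>\<^bsub>dihedral_group n\<^esub> h) = c \<cdot>\<^sub>m (rho g * rho h)"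
    by blast
qed (rule rho(1))

text \<open>The sign of \<open>act_anticommute\<close> survives the passage to unitaries because -1
  is a non-residue.\<close>

lemma rho_anticommute:
  "rho (n div 2, False) * rho (0, True) = - 1 \<cdot>\<^sub>m (rho (0, True) * rho (n div 2, False))"
proof -
  let ?g = "(n div 2, False)" and ?h = "(0, True)"
  have "rho ?g * rho ?h = of_int (- 1) \<cdot>\<^sub>m (rho ?h * rho ?g)"
  proof (rule rho_eqI[where a = "\<lambda>x. act ?h (act ?g x)" and b = "\<lambda>x. act ?g (act ?h x)"])
    show "rho ?g * rho ?h \<in> carrier_mat n n" "rho ?h * rho ?g \<in> carrier_mat n n"
      by (rule mult_carrier_mat[OF rho_carrier rho_carrier])+
    fix x assume x: "x \<in> X"
    then show "act ?g (act ?h x) = scalar (- 1) \<otimes> act ?h (act ?g x)"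
      by (intro act_anticommute) (simp add: X_eq)
    show "act ?h (act ?g x) \<in> X" using act_X x by blast
  qed (simp_all add: rho_rho_ext)
  then show ?thesis by simp
qed

text \<open>Since \<open>n\<close> is even, \<open>\<mu>\<^bsup>n/2\<^esup>\<close> and \<open>\<tau>\<close> commute, so their images would commute
  up to unitary conjugation if \<^const>\<open>rho\<close> were equivalent to a strict representation.\<close>

lemma genuine_rho: "genuine_projective_rep (dihedral_group n) n rho"
  unfolding genuine_projective_rep_def
proof (intro conjI notI projective_rho)
  let ?G = "dihedral_group n" and ?g = "(n div 2, False)" and ?h = "(0, True)"
  assume "\<exists>\<pi>'. strict_unitary_rep ?G n \<pi>' \<and> projectively_equivalent ?G n rho \<pi>'"
  then obtain \<pi>' U where strict: "strict_unitary_rep ?G n \<pi>'" and U: "unitary n U"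
    and eq: "\<And>g. g \<in> carrier ?G \<Longrightarrow> \<exists>c. cmod c = 1 \<and> U * rho g * mat_adjoint U = c \<cdot>\<^sub>m \<pi>' g"
    unfolding projectively_equivalent_def by blast
  define V where "V = mat_adjoint U"
  have UV: "U \<in> carrier_mat n n" "V \<in> carrier_mat n n" "V * U = 1\<^sub>m n"
    using U mat_adjoint_carrier by (auto simp: unitary_def V_def)
  have gh: "?g \<in> carrier ?G" "?h \<in> carrier ?G"
    using n_ge_2 by (auto simp: dihedral_group_def)
  have "n - n div 2 = n div 2" "n div 2 < n" using even_n n_ge_2 by auto
  then have comm: "?g \<otimes>\<^bsub>?G\<^esub> ?h = ?h \<otimes>\<^bsub>?G\<^esub> ?g"
    by (simp add: dihedral_group_def)
  have pi: "\<pi>' g \<in> carrier_mat n n" if "g \<in> carrier ?G" for g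
    using strict that by (simp add: strict_unitary_rep_def projective_unitary_rep_def unitary_def)
  have pi_comm: "\<pi>' ?g * \<pi>' ?h = \<pi>' ?h * \<pi>' ?g"
    using strict gh comm unfolding strict_unitary_rep_def by metis
  obtain a where a: "U * rho ?g * V = a \<cdot>\<^sub>m \<pi>' ?g" using eq[OF gh(1)] by (auto simp: V_def)
  obtain b where b: "U * rho ?h * V = b \<cdot>\<^sub>m \<pi>' ?h" using eq[OF gh(2)] by (auto simp: V_def)
  have conj: "U * (A * B) * V = (U * A * V) * (U * B * V)"
    if A: "A \<in> carrier_mat n n" and B: "B \<in> carrier_mat n n" for A B
  proof -
    have "(U * A * V) * (U * B * V) = U * A * (V * (U * (B * V)))"
      using UV(1,2) A B by (simp add: assoc_mult_mat[where n\<^sub>1=n and n\<^sub>2=n and n\<^sub>3=n and n\<^sub>4=n])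
    also have "V * (U * (B * V)) = (V * U) * (B * V)"
      using UV(1,2) A B by (simp add: assoc_mult_mat[where n\<^sub>1=n and n\<^sub>2=n and n\<^sub>3=n and n\<^sub>4=n])
    also have "\<dots> = B * V" using UV B by simp
    finally show ?thesis
      using UV(1,2) A B by (simp add: assoc_mult_mat[where n\<^sub>1=n and n\<^sub>2=n and n\<^sub>3=n and n\<^sub>4=n])
  qed
  \<comment> \<open>The phases multiply to a b in either order, so commuting strict images make the
    two conjugated products equal, not merely equal up to a phase.\<close>
  have "U * (rho ?g * rho ?h) * V = (a * b) \<cdot>\<^sub>m (\<pi>' ?g * \<pi>' ?h)"
    unfolding conj[OF rho_carrier rho_carrier] a b by (rule smult_mat_mult_smult_mat[OF pi pi]) (rule gh)+
  also have "\<dots> = U * (rho ?h * rho ?g) * V"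
    unfolding conj[OF rho_carrier rho_carrier] a b pi_comm mult.commute[of a b]
    by (rule smult_mat_mult_smult_mat[OF pi pi, symmetric]) (rule gh)+
  finally have same: "U * (rho ?g * rho ?h) * V = U * (rho ?h * rho ?g) * V" .
  have undo: "V * (U * A * V) * U = A" if A: "A \<in> carrier_mat n n" for A
  proof -
    have "V * (U * A * V) * U = (V * U) * (A * (V * U))"
      using UV(1,2) A by (simp add: assoc_mult_mat[where n\<^sub>1=n and n\<^sub>2=n and n\<^sub>3=n and n\<^sub>4=n])
    then show ?thesis using UV(3) A by simp
  qed
  let ?M = "rho ?h * rho ?g"
  have M: "?M \<in> carrier_mat n n" by (rule mult_carrier_mat[OF rho_carrier rho_carrier])
  \<comment> \<open>After undoing the conjugation, commuting and anticommuting together give -M =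
    M.\<close>
  have eq: "- 1 \<cdot>\<^sub>m ?M = ?M"
    using undo[OF M] undo[OF mult_carrier_mat[OF rho_carrier rho_carrier], of ?g ?h] same
    unfolding rho_anticommute by metis
  have M0: "?M = 0\<^sub>m n n"
  proof (rule eq_matI)
    fix i j assume "i < dim_row (0\<^sub>m n n :: complex mat)" "j < dim_col (0\<^sub>m n n :: complex mat)"
    then have ij: "i < dim_row ?M" "j < dim_col ?M" "i < n" "j < n" using M by auto
    have "- 1 * ?M $$ (i, j) = ?M $$ (i, j)"
      using arg_cong[OF eq, of "\<lambda>A. A $$ (i, j)"] index_smult_mat(1)[OF ij(1,2), of "- 1"] by simp
    then show "?M $$ (i, j) = 0\<^sub>m n n $$ (i, j)"
      using ij by simp
  qed (use M in auto)
  \<comment> \<open>M is a product of two unitaries, so cancelling both with their adjoints turns M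
    = 0 into 0 = 1 for matrices of size n > 0.\<close>
  define W where "W = mat_adjoint (rho ?h)"
  have W: "W \<in> carrier_mat n n" "W * rho ?h = 1\<^sub>m n"
    using rho(1)[of ?h] mat_adjoint_carrier[OF rho_carrier, of ?h] by (auto simp: unitary_def W_def)
  define W' where "W' = mat_adjoint (rho ?g)"
  have W': "W' \<in> carrier_mat n n" "rho ?g * W' = 1\<^sub>m n"
    using rho(1)[of ?g] mat_adjoint_carrier[OF rho_carrier, of ?g] by (auto simp: unitary_def W'_def)
  have "W * ?M * W' = (W * rho ?h) * (rho ?g * W')"
    using W(1) W'(1) rho_carrier[of ?g] rho_carrier[of ?h]
    by (simp add: assoc_mult_mat[where n\<^sub>1=n and n\<^sub>2=n and n\<^sub>3=n and n\<^sub>4=n]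
        del: rho_carrier)
  then have "0\<^sub>m n n = (1\<^sub>m n :: complex mat)"
    using W W' unfolding M0 by simp
  then have "(0\<^sub>m n n :: complex mat) $$ (0, 0) = 1\<^sub>m n $$ (0, 0)" by simp
  then show False using n_ge_2 by simp
qed

section \<open>The frame as an orbit of the representation\<close>

lemma switching_orbit:
  "switching_equivalent n P1 \<Phi> (carrier (dihedral_group n)) (\<lambda>g. rho g *\<^sub>v ext \<one>)"
  unfolding switching_equivalent_def
proof (intro exI conjI ballI)
  \<comment> \<open>The orbit vectors are frame vectors up to these signs, so the identity serves as
    the unitary, the orbit map as the permutation and the signs as the phases.\<close>
  let ?d = "\<lambda>g. of_int (chi q (coef (act g \<one>)))"
  show "unitary n (1\<^sub>m n)"
  proof -
    have "mat_adjoint (1\<^sub>m n) = (1\<^sub>m n :: complex mat)"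
    proof (rule eq_matI)
      fix i j assume "i < dim_row (1\<^sub>m n :: complex mat)" "j < dim_col (1\<^sub>m n :: complex mat)"
      then show "mat_adjoint (1\<^sub>m n) $$ (i, j) = (1\<^sub>m n :: complex mat) $$ (i, j)"
        by (simp add: index_mat_adjoint[of _ n n])
    qed (use mat_adjoint_carrier[OF one_carrier_mat, of n] in auto)
    then show ?thesis by (simp add: unitary_def)
  qed
  show "bij_betw (\<lambda>g. cls (act g \<one>)) (carrier (dihedral_group n)) P1" by (rule bij_betw_orbit)
  fix g assume "g \<in> carrier (dihedral_group n)"
  show "cmod (?d g) = 1" using chi_range[of q "coef (act g \<one>)"] by auto
  have "1\<^sub>m n *\<^sub>v \<Phi> (cls (act g \<one>)) = \<Phi> (cls (act g \<one>))"
    using Phi_carrier cls_P1 act_X one_X by simp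
  then show "rho g *\<^sub>v ext \<one> = ?d g \<cdot>\<^sub>v (1\<^sub>m n *\<^sub>v \<Phi> (cls (act g \<one>)))"
    using rho_ext[OF one_X] by (simp add: ext_def)
qed

lemma unit_ext_one: "unit_vector n (ext \<one>)"
proof -
  have "gram ext \<one> \<one> = of_int (chi q 1)"
    using q_gt_2 by (intro gram_ext(1)[OF one_X one_X]) auto
  then show ?thesis
    using ext_carrier[OF one_X] by (simp add: unit_vector_def gram_def chi_1)
qed

end

theorem theorem5p6:
  fixes q n :: nat
    and rep :: "(int \<times> int) set \<Rightarrow> int \<times> int"
    and \<Phi> :: "(int \<times> int) set \<Rightarrow> complex vec"
  assumes "prime q" and "[q = 3] (mod 4)" and "n = (q + 1) div 2"
    and "representatives (residue_ring (int q)) rep"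
    and "paley_etf q rep \<Phi>"
  shows "\<exists>\<pi> v. genuine_projective_rep (dihedral_group n) n \<pi> \<and> unit_vector n v \<and>
    switching_equivalent n (projective_line (residue_ring (int q))) \<Phi>
      (carrier (dihedral_group n)) (\<lambda>g. \<pi> g *\<^sub>v v)"
proof -
  interpret paley_config q n "gauss_ring (int q)" rep \<Phi>
    by unfold_locales (use assms in simp_all)
  show ?thesis
    using genuine_rho unit_ext_one switching_orbit by blast
qed

end
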